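(* Let $(\mathfrak{A},\varphi,T)$ be a state preserving $C^*$-dynamical system, and consider the following assertions: (i) the state preserving $C^*$-dynamical system $(\mathfrak{A}\otimes\mathfrak{A},\varphi\otimes\varphi,T\otimes T)$ is uniquely ergodic; (ii) $(\mathfrak{A},\varphi,T)$ is strictly weak mixing; (iii) the state preserving $C^*$-dynamical system $(\mathfrak{A}\otimes\mathfrak{A},\varphi\otimes\varphi,T\otimes T)$ is strictly weak mixing. Then the implication (i)$\Rightarrow$(ii) holds. If, in addition, $\mathfrak{A}^*\otimes\mathfrak{A}^*=(\mathfrak{A}\otimes\mathfrak{A})^*$, then (i), (ii) and (iii) are all equivalent.
   Context: All $C^*$-algebras are unital, with unit denoted $\mathbf{1}$; $\mathfrak{A}^*$ is the Banach space dual of $\mathfrak{A}$. A ucp map is a completely positive linear map $T:\mathfrak{A}\to\mathfrak{A}$ with $T\mathbf{1}=\mathbf{1}$. A state preserving $C^*$-dynamical system is a triple $(\mathfrak{A},\varphi,T)$ consisting of a unital $C^*$-algebra $\mathfrak{A}$, a state $\varphi$ on $\mathfrak{A}$ and a ucp map $T$ on $\mathfrak{A}$ with $\varphi\circ T=\varphi$. It is called: - uniquely ergodic (with respect to $\varphi$) if $\varphi$ is the only state on $\mathfrak{A}$ invariant under $T$; - strictly weak mixing (with respect to $\varphi$) if $\lim_{n\to\infty}\frac1n\sum_{k=0}^{n-1}|\psi(T^k(x))-\psi(\mathbf{1})\varphi(x)|=0$ for all $x\in\mathfrak{A}$ and $\psi\in\mathfrak{A}^*$. $\mathfrak{A}\otimes\mathfrak{B}$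 denotes the minimal $C^*$-tensor product, i.e. the completion of the algebraic tensor product $\mathfrak{A}\odot\mathfrak{B}$ in the minimal $C^*$-tensor norm. $\varphi\otimes\varphi_1$ is the product state on it, and for ucp maps $T$ on $\mathfrak{A}$ and $H$ on $\mathfrak{B}$, $T\otimes H$ is the ucp map on $\mathfrak{A}\otimes\mathfrak{B}$ determined by $(T\otimes H)(x\otimes y)=Tx\otimes Hy$. The condition $\mathfrak{A}^*\otimes\mathfrak{B}^*=(\mathfrak{A}\otimes\mathfrak{B})^*$ means that the linear span $\mathfrak{A}^*\odot\mathfrak{B}^*$ of the product functionals $\psi\otimes\phi$ ($\psi\in\mathfrak{A}^*$, $\phi\in\mathfrak{B}^*$) is norm-dense in the Banach space dual $(\mathfrak{A}\otimes\mathfrak{B})^*$. *)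

theory Defs
  imports "HOL-Analysis.Analysis"
begin

class unital_cstar_algebra = real_normed_algebra_1 + banach +
  fixes scaleC :: "complex \<Rightarrow> 'a \<Rightarrow> 'a" (infixr "*\<^sub>C" 75)
    and adj :: "'a \<Rightarrow> 'a"
  assumes scaleC_of_real: "complex_of_real r *\<^sub>C x = r *\<^sub>R x"
    and scaleC_add_left: "(c + d) *\<^sub>C x = c *\<^sub>C x + d *\<^sub>C x"
    and scaleC_add_right: "c *\<^sub>C (x + y) = c *\<^sub>C x + c *\<^sub>C y"
    and scaleC_scaleC: "c *\<^sub>C d *\<^sub>C x = (c * d) *\<^sub>C x"
    and mult_scaleC_left: "(c *\<^sub>C x) * y = c *\<^sub>C (x * y)"
    and mult_scaleC_right: "x * (c *\<^sub>C y) = c *\<^sub>C (x * y)"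
    and norm_scaleC: "norm (c *\<^sub>C x) = cmod c * norm x"
    and adj_adj: "adj (adj x) = x"
    and adj_add: "adj (x + y) = adj x + adj y"
    and adj_scaleC: "adj (c *\<^sub>C x) = cnj c *\<^sub>C adj x"
    and adj_mult: "adj (x * y) = adj y * adj x"
    and norm_adj_mult_self: "norm (adj x * x) = (norm x)\<^sup>2"

instantiation complex :: unital_cstar_algebra
begin

definition scaleC_complex :: "complex \<Rightarrow> complex \<Rightarrow> complex"
  where "scaleC_complex c z = c * z"

definition adj_complex :: "complex \<Rightarrow> complex"
  where "adj_complex z = cnj z"

instance
  by standard
    (auto simp: scaleC_complex_def adj_complex_def algebra_simps scaleR_conv_of_real
      norm_mult power2_eq_square)

end

global_interpretation cvec: vector_space "scaleC :: complex \<Rightarrow> 'a \<Rightarrow> 'a::unital_cstar_algebra"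
  using scaleC_of_real[of 1]
  by unfold_locales (auto simp: scaleC_add_left scaleC_add_right scaleC_scaleC)

abbreviation clinear :: "('a::unital_cstar_algebra \<Rightarrow> 'b::unital_cstar_algebra) \<Rightarrow> bool"
  where "clinear \<equiv> Vector_Spaces.linear scaleC scaleC"

definition cdual :: "('a::unital_cstar_algebra \<Rightarrow> complex) set"
  where "cdual = {f. clinear f \<and> bounded_linear f}"

definition state :: "('a::unital_cstar_algebra \<Rightarrow> complex) \<Rightarrow> bool"
  where "state f \<longleftrightarrow> clinear f \<and> (\<forall>x. f (adj x * x) \<in> \<real>\<^sub>\<ge>\<^sub>0) \<and> f 1 = 1"

text \<open>Matrices in \<open>M\<^sub>n(A)\<close> are functions of two indices, of which only the values below \<open>n\<close>
  matter. The positive elements of the C*-algebra \<open>M\<^sub>n(A)\<close> are those of the form \<open>Y\<^sup>*Y\<close>.\<close>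

definition mat_positive :: "nat \<Rightarrow> (nat \<Rightarrow> nat \<Rightarrow> 'a::unital_cstar_algebra) \<Rightarrow> bool"
  where "mat_positive n M \<longleftrightarrow>
    (\<exists>Y. \<forall>i<n. \<forall>j<n. M i j = (\<Sum>k<n. adj (Y k i) * Y k j))"

definition completely_positive ::
    "('a::unital_cstar_algebra \<Rightarrow> 'b::unital_cstar_algebra) \<Rightarrow> bool"
  where "completely_positive T \<longleftrightarrow>
    clinear T \<and> (\<forall>n M. mat_positive n M \<longrightarrow> mat_positive n (\<lambda>i j. T (M i j)))"

definition ucp :: "('a::unital_cstar_algebra \<Rightarrow> 'a) \<Rightarrow> bool"
  where "ucp T \<longleftrightarrow> completely_positive T \<and> T 1 = 1"

definition state_preserving_system ::
    "('a::unital_cstar_algebra \<Rightarrow> complex) \<Rightarrow> ('a \<Rightarrow> 'a) \<Rightarrow> bool"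
  where "state_preserving_system \<phi> T \<longleftrightarrow> state \<phi> \<and> ucp T \<and> \<phi> \<circ> T = \<phi>"

definition uniquely_ergodic ::
    "('a::unital_cstar_algebra \<Rightarrow> complex) \<Rightarrow> ('a \<Rightarrow> 'a) \<Rightarrow> bool"
  where "uniquely_ergodic \<phi> T \<longleftrightarrow> {\<omega>. state \<omega> \<and> \<omega> \<circ> T = \<omega>} = {\<phi>}"

definition strictly_weak_mixing ::
    "('a::unital_cstar_algebra \<Rightarrow> complex) \<Rightarrow> ('a \<Rightarrow> 'a) \<Rightarrow> bool"
  where "strictly_weak_mixing \<phi> T \<longleftrightarrow>
    (\<forall>x. \<forall>\<psi>\<in>cdual.
      (\<lambda>n. (1 / real n) * (\<Sum>k<n. cmod (\<psi> ((T ^^ k) x) - \<psi> 1 * \<phi> x))) \<longlonglongrightarrow> 0)"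

text \<open>A list \<open>[(a\<^sub>1, b\<^sub>1), \<dots>, (a\<^sub>m, b\<^sub>m)]\<close> represents the element
  \<open>\<Sum>\<^sub>i a\<^sub>i \<otimes> b\<^sub>i\<close> of the algebraic tensor product. The next three functions are, in terms of
  such representatives, the product and the involution of the algebraic tensor product, and the
  product functional \<open>f \<otimes> g\<close> on it.\<close>

definition alg_mult ::
    "('a::times \<times> 'b::times) list \<Rightarrow> ('a \<times> 'b) list \<Rightarrow> ('a \<times> 'b) list"
  where "alg_mult xs ys = [(a * c, b * d). (a, b) \<leftarrow> xs, (c, d) \<leftarrow> ys]"

definition alg_adj ::
    "('a::unital_cstar_algebra \<times> 'b::unital_cstar_algebra) list \<Rightarrow> ('a \<times> 'b) list"
  where "alg_adj xs = [(adj a, adj b). (a, b) \<leftarrow> xs]"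

definition alg_functional ::
    "('a \<Rightarrow> complex) \<Rightarrow> ('b \<Rightarrow> complex) \<Rightarrow> ('a \<times> 'b) list \<Rightarrow> complex"
  where "alg_functional f g xs = (\<Sum>(a, b)\<leftarrow>xs. f a * g b)"

text \<open>The minimal (spatial) C*-norm on the algebraic tensor product, i.e. the supremum of
  \<open>\<parallel>(\<pi>\<^sub>f \<otimes> \<pi>\<^sub>g)(x)\<parallel>\<close> over the GNS representations of states \<open>f\<close>, \<open>g\<close>, where the operator norm is
  evaluated on the dense set of vectors \<open>(\<pi>\<^sub>f \<otimes> \<pi>\<^sub>g)(y) (\<xi>\<^sub>f \<otimes> \<xi>\<^sub>g)\<close>:
    \<open>\<parallel>x\<parallel>\<^sup>2 = sup (f \<otimes> g)(y\<^sup>* x\<^sup>* x y) / (f \<otimes> g)(y\<^sup>* y)\<close>.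
  This is the form in which Turumaru introduced the norm (see also Sakai, C*-Algebras and
  W*-Algebras, 1.22). Both values of \<open>f \<otimes> g\<close> are nonnegative reals, so \<open>Re\<close> loses nothing.\<close>

definition min_tensor_norm ::
    "('a::unital_cstar_algebra \<times> 'b::unital_cstar_algebra) list \<Rightarrow> real"
  where "min_tensor_norm x = sqrt (Sup
    {Re (alg_functional f g (alg_mult (alg_adj y) (alg_mult (alg_adj x) (alg_mult x y))))
       / Re (alg_functional f g (alg_mult (alg_adj y) y)) | f g y.
      state f \<and> state g \<and> alg_functional f g (alg_mult (alg_adj y) y) \<noteq> 0})"

text \<open>The completion of the algebraic tensor product \<open>A \<odot> B\<close> in the minimal norm is unique only up
  to isomorphism; the predicate says that the C*-algebra \<open>'c\<close>, with \<open>tens a b\<close> in the role of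
  \<open>a \<otimes> b\<close>, is such a completion. The first two conditions make the linear span of the
  elementary tensors a copy of the vector space \<open>A \<odot> B\<close> (bilinear, and injective on
  \<open>A \<odot> B\<close>), the next three fix its *-algebra structure, the last two its norm and density
  (completeness being part of the class).\<close>

definition is_min_tensor_product ::
    "('a::unital_cstar_algebra \<Rightarrow> 'b::unital_cstar_algebra \<Rightarrow> 'c::unital_cstar_algebra) \<Rightarrow> bool"
  where "is_min_tensor_product tens \<longleftrightarrow>
    (\<forall>a. clinear (\<lambda>b. tens a b)) \<and> (\<forall>b. clinear (\<lambda>a. tens a b)) \<and>
    (\<forall>E f. finite E \<and> cvec.independent E \<and> (\<Sum>e\<in>E. tens e (f e)) = 0 \<longrightarrow> (\<forall>e\<in>E. f e = 0)) \<and>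
    (\<forall>a b c d. tens a b * tens c d = tens (a * c) (b * d)) \<and>
    (\<forall>a b. adj (tens a b) = tens (adj a) (adj b)) \<and>
    tens 1 1 = 1 \<and>
    (\<forall>x. norm (\<Sum>(a, b)\<leftarrow>x. tens a b) = min_tensor_norm x) \<and>
    closure (cvec.span {tens a b | a b. True}) = UNIV"

definition is_product_state ::
    "('a::unital_cstar_algebra \<Rightarrow> 'b::unital_cstar_algebra \<Rightarrow> 'c::unital_cstar_algebra) \<Rightarrow>
     ('a \<Rightarrow> complex) \<Rightarrow> ('b \<Rightarrow> complex) \<Rightarrow> ('c \<Rightarrow> complex) \<Rightarrow> bool"
  where "is_product_state tens \<phi> \<phi>\<^sub>1 \<Phi> \<longleftrightarrow>
    state \<Phi> \<and> (\<forall>a b. \<Phi> (tens a b) = \<phi> a * \<phi>\<^sub>1 b)"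

definition is_tensor_ucp ::
    "('a::unital_cstar_algebra \<Rightarrow> 'b::unital_cstar_algebra \<Rightarrow> 'c::unital_cstar_algebra) \<Rightarrow>
     ('a \<Rightarrow> 'a) \<Rightarrow> ('b \<Rightarrow> 'b) \<Rightarrow> ('c \<Rightarrow> 'c) \<Rightarrow> bool"
  where "is_tensor_ucp tens T H S \<longleftrightarrow>
    ucp S \<and> (\<forall>a b. S (tens a b) = tens (T a) (H b))"

definition product_functionals ::
    "('a::unital_cstar_algebra \<Rightarrow> 'b::unital_cstar_algebra \<Rightarrow> 'c::unital_cstar_algebra) \<Rightarrow>
     ('c \<Rightarrow> complex) set"
  where "product_functionals tens =
    {G \<in> cdual. \<exists>\<psi>\<in>cdual. \<exists>\<phi>\<in>cdual. \<forall>a b. G (tens a b) = \<psi> a * \<phi> b}"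

text \<open>Norm density of the linear span of the product functionals in the dual. Scalar multiples of
  product functionals are product functionals, so finite sums exhaust the span.\<close>

definition product_functionals_dense ::
    "('a::unital_cstar_algebra \<Rightarrow> 'b::unital_cstar_algebra \<Rightarrow> 'c::unital_cstar_algebra) \<Rightarrow> bool"
  where "product_functionals_dense tens \<longleftrightarrow>
    (\<forall>F\<in>cdual. \<forall>\<epsilon>>0. \<exists>(m::nat) G. (\<forall>i<m. G i \<in> product_functionals tens) \<and>
      onorm (\<lambda>z. F z - (\<Sum>i<m. G i z)) < \<epsilon>)"

end

theory Submission
  imports Defs
begin

text \<open>(i) implies (ii): if \<open>\<phi> \<otimes> \<phi>\<close> is the only invariant state, then the ergodic averages of every
  state converge to it pointwise, since a limit functional of the averages (obtained from
  Hahn-Banach) is an invariant state. For a state \<open>\<psi>\<close> and \<open>x\<close> with \<open>\<phi>(x) = 0\<close>, apply this to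
  \<open>\<psi> \<otimes> \<psi>\<close> and \<open>x \<otimes> x\<^sup>*\<close> to see that the averages of \<open>\<bar>\<psi>(T\<^sup>k x)\<bar>\<^sup>2\<close> tend to \<open>0\<close>; general
  functionals are combinations of four states. (ii) implies (iii) on product functionals and
  elementary tensors because \<open>\<bar>\<alpha> \<beta> - \<alpha>\<^sub>0 \<beta>\<^sub>0\<bar> \<le> \<bar>\<alpha> - \<alpha>\<^sub>0\<bar> \<bar>\<beta>\<bar> + \<bar>\<alpha>\<^sub>0\<bar> \<bar>\<beta> - \<beta>\<^sub>0\<bar>\<close>, and by density in general.
  (iii) implies (i) by evaluating on invariant states.

  The C*-theory needed (positivity of \<open>y\<^sup>* y\<close>, decomposition of functionals into states) is
  obtained without spectra: square roots come from the binomial series of \<open>(1 - w)\<^bsup>1/2\<^esup>\<close>,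
  which converges absolutely for \<open>\<parallel>w\<parallel> \<le> 1\<close>, and order bounds on norms are used up to
  constant factors only.\<close>

section \<open>Sublinear functionals\<close>

text \<open>Two obstacles shape the development. Ergodic averages of a state need not converge, and
  no compactness of the state space is invoked; instead Hahn-Banach is used in a form that also
  prescribes the value at one vector. Thus the limsup of the averages at a self-adjoint z is
  attained by an invariant state, and uniqueness pins it to \<Phi>(z); applying this to -z controls
  the liminf. Secondly, the tensor product is known only through lists of elementary tensors and a
  norm given as a supremum, so the state \<psi> \<otimes> \<psi> has to be produced. The factor x^*
  is paired with x because positive maps commute with the involution, which makes the product value
  a squared modulus. Norm estimates along the iterates must be uniform in k, but their constants are
  immaterial.\<close>

definition sublinear :: "('v::real_vector \<Rightarrow> real) \<Rightarrow> bool"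
  where "sublinear p \<longleftrightarrow>
    (\<forall>x y. p (x + y) \<le> p x + p y) \<and> (\<forall>c>0. \<forall>x. p (c *\<^sub>R x) = c * p x)"

lemma sublinear_add: "sublinear p \<Longrightarrow> p (x + y) \<le> p x + p y"
  and sublinear_scaleR: "sublinear p \<Longrightarrow> c > 0 \<Longrightarrow> p (c *\<^sub>R x) = c * p x"
  by (auto simp: sublinear_def)

lemma sublinear_0: "sublinear p \<Longrightarrow> p 0 = 0"
  using sublinear_scaleR[of p 2 0] by simp

lemma sublinear_minus: "sublinear p \<Longrightarrow> - p (- x) \<le> p x"
  using sublinear_add[of p x "- x"] sublinear_0[of p] by simp

text \<open>Every auxiliary functional below is an infimum over a set of admissible values
  compatible with sums and positive multiples, so sublinearity is settled once here. The two halves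
  of homogeneity are the same inequality for \<open>c\<close> and \<open>inverse c\<close>.\<close>

lemma sublinear_Inf:
  fixes S :: "'v::real_vector \<Rightarrow> real set"
  assumes ne: "\<And>v. S v \<noteq> {}" and bdd: "\<And>v. bdd_below (S v)"
    and add: "\<And>v w a b. a \<in> S v \<Longrightarrow> b \<in> S w \<Longrightarrow> a + b \<in> S (v + w)"
    and scale: "\<And>v a c. c > 0 \<Longrightarrow> a \<in> S v \<Longrightarrow> c * a \<in> S (c *\<^sub>R v)"
  shows "sublinear (\<lambda>v. Inf (S v))"
  unfolding sublinear_def
proof (intro conjI allI impI)
  fix v w
  have "Inf (S (v + w)) - a \<le> Inf (S w)" if "a \<in> S v" for a
    using that by (intro cInf_greatest ne) (use add cInf_lower[OF _ bdd] in force)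
  then have "Inf (S (v + w)) - Inf (S w) \<le> Inf (S v)"
    by (intro cInf_greatest ne) force
  then show "Inf (S (v + w)) \<le> Inf (S v) + Inf (S w)" by simp
next
  fix c :: real and v
  have le: "Inf (S (c *\<^sub>R v)) \<le> c * Inf (S v)" if "c > 0" for c v
  proof -
    have "Inf (S (c *\<^sub>R v)) / c \<le> Inf (S v)"
      using that by (intro cInf_greatest ne)
        (auto simp: field_simps intro!: cInf_lower[OF _ bdd] dest: scale)
    then show ?thesis using that by (simp add: field_simps)
  qed
  assume c: "c > 0"
  have "Inf (S v) \<le> inverse c * Inf (S (c *\<^sub>R v))"
    using le[of "inverse c" "c *\<^sub>R v"] c by simp
  then show "Inf (S (c *\<^sub>R v)) = c * Inf (S v)"
    using le[OF c, of v] c by (simp add: field_simps)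
qed

text \<open>The witness is q(x) = inf {p(x + t y) - t p(y) | t >= 0}: t = 0 gives q \<le> p, and t =
  1 at x = -y gives q(-y) \<le> p(0) - p(y) = -p(y). A linear functional below q therefore agrees
  with p at y.\<close>

lemma sublinear_tilt:
  assumes p: "sublinear p"
  shows "\<exists>q. sublinear q \<and> q \<le> p \<and> q (- y) \<le> - p y"
proof -
  define S where "S x = {r. \<exists>t\<ge>0. p (x + t *\<^sub>R y) - t * p y \<le> r}" for x
  have p0: "p (t *\<^sub>R z) = t * p z" if "t \<ge> 0" for t z
    using that sublinear_scaleR[OF p, of t z] sublinear_0[OF p] by (cases "t = 0") auto
  have low: "- p (- x) \<le> s" if s: "s \<in> S x" for x s
  proof -
    obtain t where t: "t \<ge> 0" "p (x + t *\<^sub>R y) - t * p y \<le> s" using s by (auto simp: S_def)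
    have "t * p y \<le> p (x + t *\<^sub>R y) + p (- x)"
      using sublinear_add[OF p, of "x + t *\<^sub>R y" "- x"] p0[OF t(1)] by simp
    then show ?thesis using t by simp
  qed
  have memp: "p x \<in> S x" for x
    unfolding S_def by (rule CollectI, rule exI[of _ 0]) simp
  have bdd: "bdd_below (S x)" for x using low by (force simp: bdd_below_def)
  have "sublinear (\<lambda>x. Inf (S x))"
  proof (rule sublinear_Inf)
    show "S v \<noteq> {}" for v using memp by blast
    show "bdd_below (S v)" for v by (rule bdd)
  next
    fix v w a b assume "a \<in> S v" "b \<in> S w"
    then obtain s t where s: "s \<ge> 0" "p (v + s *\<^sub>R y) - s * p y \<le> a"
      and t: "t \<ge> 0" "p (w + t *\<^sub>R y) - t * p y \<le> b" by (auto simp: S_def)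
    have "p (v + w + (s + t) *\<^sub>R y) - (s + t) * p y \<le> a + b"
      using sublinear_add[OF p, of "v + s *\<^sub>R y" "w + t *\<^sub>R y"] s t
      by (simp add: algebra_simps)
    then show "a + b \<in> S (v + w)"
      using s(1) t(1) unfolding S_def by (intro CollectI exI[of _ "s + t"]) simp
  next
    fix v a and c :: real assume c: "c > 0" and "a \<in> S v"
    then obtain s where s: "s \<ge> 0" "p (v + s *\<^sub>R y) - s * p y \<le> a" by (auto simp: S_def)
    have "c * (p (v + s *\<^sub>R y) - s * p y) \<le> c * a" using s c by simp
    then have "p (c *\<^sub>R v + (c * s) *\<^sub>R y) - (c * s) * p y \<le> c * a"
      using sublinear_scaleR[OF p c, of "v + s *\<^sub>R y"] by (simp add: algebra_simps)
    then show "c * a \<in> S (c *\<^sub>R v)"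
      using s(1) c unfolding S_def by (intro CollectI exI[of _ "c * s"]) simp
  qed
  moreover have "Inf (S x) \<le> p x" for x by (rule cInf_lower[OF memp bdd])
  moreover have "Inf (S (- y)) \<le> - p y"
    by (rule cInf_lower[OF _ bdd]) (auto simp: S_def sublinear_0[OF p] intro!: exI[of _ 1])
  ultimately show ?thesis by (auto simp: le_fun_def)
qed

text \<open>Zorn for the reversed pointwise order. The infimum of a chain stays finite because q
  \<le> p forces q(x) >= -q(-x) >= -p(-x); it is subadditive because of two members of a chain one
  lies below the other.\<close>

lemma minimal_sublinear_exists:
  fixes p :: "'v::real_vector \<Rightarrow> real"
  assumes p: "sublinear p"
  shows "\<exists>m. sublinear m \<and> m \<le> p \<and> (\<forall>q. sublinear q \<and> q \<le> m \<longrightarrow> q = m)"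
proof -
  define A where "A = {q. sublinear q \<and> q \<le> p}"
  have "\<exists>m\<in>A. \<forall>a\<in>A. a \<le> m \<longrightarrow> a = m"
  proof (rule predicate_Zorn[where P = "\<lambda>x y. y \<le> x", THEN bexE])
    show "partial_order_on A (relation_of (\<lambda>x y. y \<le> x) A)"
      by (rule partial_order_on_relation_ofI) auto
  next
    fix C assume "C \<in> Chains (relation_of (\<lambda>x y. y \<le> x) A)"
    then have CA: "C \<subseteq> A" and ch: "\<And>a b. a \<in> C \<Longrightarrow> b \<in> C \<Longrightarrow> a \<le> b \<or> b \<le> a"
      by (auto simp: Chains_def relation_of_def)
    show "\<exists>u\<in>A. \<forall>a\<in>C. u \<le> a"
    proof (cases "C = {}")
      case True
      then show ?thesis using p by (auto simp: A_def)
    next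
      case False
      define S where "S x = {r. \<exists>q\<in>C. q x \<le> r}" for x
      have low: "- p (- x) \<le> r" if "r \<in> S x" for x r
      proof -
        obtain q where q: "q \<in> C" "q x \<le> r" using \<open>r \<in> S x\<close> by (auto simp: S_def)
        then have "sublinear q" "q (- x) \<le> p (- x)" using CA by (auto simp: A_def le_fun_def)
        then show ?thesis using sublinear_minus[of q x] q by linarith
      qed
      have bdd: "bdd_below (S x)" for x using low by (force simp: bdd_below_def)
      have "sublinear (\<lambda>x. Inf (S x))"
      proof (rule sublinear_Inf)
        show "S v \<noteq> {}" for v using False by (auto simp: S_def)
        show "bdd_below (S v)" for v by (rule bdd)
      next
        fix v w a b assume "a \<in> S v" "b \<in> S w"
        then obtain q r where q: "q \<in> C" "q v \<le> a" and r: "r \<in> C" "r w \<le> b"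
          by (auto simp: S_def)
        obtain s where s: "s \<in> C" "s \<le> q" "s \<le> r" using ch[OF q(1) r(1)] q r by blast
        then have "sublinear s" using CA by (auto simp: A_def)
        then have "s (v + w) \<le> a + b"
          using sublinear_add[of s v w] le_funD[OF s(2), of v] le_funD[OF s(3), of w] q r
          by linarith
        then show "a + b \<in> S (v + w)" using s by (auto simp: S_def)
      next
        fix v a and c :: real assume c: "c > 0" and "a \<in> S v"
        then obtain q where q: "q \<in> C" "q v \<le> a" by (auto simp: S_def)
        then have "q (c *\<^sub>R v) \<le> c * a"
          using CA sublinear_scaleR[of q c v] c by (auto simp: A_def)
        then show "c * a \<in> S (c *\<^sub>R v)" using q by (auto simp: S_def)
      qed
      moreover have le: "Inf (S x) \<le> q x" if "q \<in> C" for q x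
        using that by (intro cInf_lower bdd) (auto simp: S_def)
      moreover have "Inf (S x) \<le> p x" for x
      proof -
        obtain q where "q \<in> C" using False by blast
        then have "q x \<le> p x" using CA by (auto simp: A_def le_fun_def)
        then show ?thesis using le[OF \<open>q \<in> C\<close>, of x] by linarith
      qed
      ultimately show ?thesis
        by (intro bexI[of _ "\<lambda>x. Inf (S x)"]) (auto simp: A_def le_fun_def)
    qed
  qed blast
  then obtain m where "m \<in> A" and m: "\<And>a. a \<in> A \<Longrightarrow> a \<le> m \<Longrightarrow> a = m" by blast
  moreover have "q = m" if "sublinear q" "q \<le> m" for q
    using that \<open>m \<in> A\<close> by (intro m) (auto simp: A_def)
  ultimately show ?thesis by (auto simp: A_def)
qed

text \<open>A minimal functional equals its own tilt at every vector, which forces m(-x) = -m(x); an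
  odd sublinear functional is linear.\<close>

lemma minimal_sublinear_linear:
  fixes m :: "'v::real_vector \<Rightarrow> real"
  assumes m: "sublinear m" and min: "\<And>q. sublinear q \<Longrightarrow> q \<le> m \<Longrightarrow> q = m"
  shows "linear m"
proof -
  have neg: "m (- x) = - m x" for x
  proof -
    obtain q where "sublinear q" "q \<le> m" "q (- x) \<le> - m x" using sublinear_tilt[OF m] by blast
    then have "m (- x) \<le> - m x" using min[of q] by simp
    then show ?thesis using sublinear_minus[OF m, of x] by simp
  qed
  have "m (c *\<^sub>R x) = c * m x" for c x
  proof (cases c "0 :: real" rule: linorder_cases)
    case less
    then show ?thesis using sublinear_scaleR[OF m, of "- c" x] neg[of "c *\<^sub>R x"] by simp
  qed (use sublinear_scaleR[OF m] sublinear_0[OF m] in auto)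
  moreover have "m (x + y) = m x + m y" for x y
    using sublinear_add[OF m, of x y] sublinear_add[OF m, of "- x" "- y"] neg[of x] neg[of y]
      neg[of "x + y"] by simp
  ultimately show ?thesis by (intro linearI) auto
qed

text \<open>Data to be extended from a subspace are built into \<open>p\<close> itself. Tilting at
  \<open>y\<close> before passing to a minimal functional is what yields equality at
  \<open>y\<close>.\<close>

theorem hahn_banach_sublinear:
  fixes p :: "'v::real_vector \<Rightarrow> real"
  assumes p: "sublinear p"
  shows "\<exists>g. linear g \<and> (\<forall>x. g x \<le> p x) \<and> g y = p y"
proof -
  obtain q where q: "sublinear q" "q \<le> p" "q (- y) \<le> - p y"
    using sublinear_tilt[OF p] by blast
  obtain g where g: "sublinear g" "g \<le> q" "\<And>r. sublinear r \<Longrightarrow> r \<le> g \<Longrightarrow> r = g"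
    using minimal_sublinear_exists[OF q(1)] by blast
  have lin: "linear g" by (rule minimal_sublinear_linear[OF g(1,3)])
  have le: "g x \<le> p x" for x using g(2) q(2) by (auto simp: le_fun_def intro: order_trans)
  have "- g y \<le> - p y"
    using g(2) q(3) linear_neg[OF lin, of y] by (metis le_funD order_trans)
  then show ?thesis using lin le[of y] le by (intro exI[of _ g]) auto
qed

section \<open>Square roots and the positive cone\<close>

lemma clinear_iff:
  "clinear f \<longleftrightarrow> (\<forall>x y. f (x + y) = f x + f y) \<and> (\<forall>c x. f (c *\<^sub>C x) = c *\<^sub>C f x)"
  by (simp add: Vector_Spaces.linear_def module_hom_iff cvec.vector_space_axioms
      cvec.module_axioms)

lemma clinear_add: "clinear f \<Longrightarrow> f (x + y) = f x + f y"
  and clinear_scaleC: "clinear f \<Longrightarrow> f (c *\<^sub>C x) = c *\<^sub>C f x"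
  by (auto simp: clinear_iff)

lemma clinear_scaleR: "clinear f \<Longrightarrow> f (r *\<^sub>R x) = r *\<^sub>R f x"
  using clinear_scaleC[of f "complex_of_real r" x] by (simp add: scaleC_of_real)

lemma clinear_imp_linear: "clinear f \<Longrightarrow> linear f"
  by (intro linearI) (auto simp: clinear_add clinear_scaleR)

lemma clinear_0: "clinear f \<Longrightarrow> f 0 = 0"
  and clinear_minus: "clinear f \<Longrightarrow> f (- x) = - f x"
  and clinear_diff: "clinear f \<Longrightarrow> f (x - y) = f x - f y"
  and clinear_sum: "clinear f \<Longrightarrow> f (sum h I) = (\<Sum>i\<in>I. f (h i))"
  by (auto simp: clinear_imp_linear linear_0 linear_neg linear_diff linear_sum)

lemma adj_scaleR: "adj (r *\<^sub>R x) = r *\<^sub>R adj x"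
  using adj_scaleC[of "complex_of_real r" x] by (simp add: scaleC_of_real)

lemma adj_linear: "linear adj"
  by (intro linearI) (auto simp: adj_add adj_scaleR)

lemma adj_0: "adj 0 = 0"
  and adj_minus: "adj (- x) = - adj x"
  and adj_diff: "adj (x - y) = adj x - adj y"
  using adj_linear linear_0 linear_neg linear_diff by blast+

lemma adj_1: "adj 1 = 1"
  using adj_mult[of "adj 1" 1] by (simp add: adj_adj)

lemma adj_power: "adj (x ^ n) = adj x ^ n"
  by (induction n) (auto simp: adj_1 adj_mult power_commutes)

lemmas adj_simps = adj_0 adj_1 adj_add adj_minus adj_diff adj_scaleR adj_scaleC adj_mult
  adj_adj adj_power

lemma norm_adj: "norm (adj x) = norm x"
proof -
  have le: "norm x \<le> norm (adj x)" for x :: 'a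
  proof (cases "x = 0")
    case False
    have "norm x * norm x \<le> norm (adj x) * norm x"
      using norm_mult_ineq[of "adj x" x] by (simp add: norm_adj_mult_self power2_eq_square)
    then show ?thesis using False by simp
  qed simp
  show ?thesis using le[of x] le[of "adj x"] by (simp add: adj_adj)
qed

lemma bounded_linear_adj: "bounded_linear adj"
  using adj_linear by (intro bounded_linear_intro[of _ 1])
    (auto simp: adj_add adj_scaleR norm_adj)

lemma norm_square_selfadj: "adj h = h \<Longrightarrow> norm (h * h) = (norm h)\<^sup>2"
  using norm_adj_mult_self[of h] by simp

text \<open>The coefficients of the binomial series of \<open>(1 - w)\<^bsup>1/2\<^esup>\<close>.\<close>

definition sqrt_coeff :: "nat \<Rightarrow> real"
  where "sqrt_coeff k = pochhammer (- 1 / 2) k / fact k"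

lemma sqrt_coeff_0: "sqrt_coeff 0 = 1"
  by (simp add: sqrt_coeff_def)

lemma sqrt_coeff_Suc_le_0: "sqrt_coeff (Suc k) \<le> 0"
proof -
  have "pochhammer (- 1 / 2 :: real) (Suc k) = - 1 / 2 * pochhammer (1 / 2) k"
    by (simp add: pochhammer_rec)
  moreover have "pochhammer (1 / 2 :: real) k \<ge> 0" by (simp add: pochhammer_nonneg)
  ultimately show ?thesis by (simp add: sqrt_coeff_def)
qed

text \<open>The right-hand side is the n-th coefficient of (1 - w)^(-1/2), since dividing by 1 - w
  turns coefficients into partial sums. Only its sign is used later.\<close>

lemma sum_sqrt_coeff: "(\<Sum>k\<le>n. sqrt_coeff k) = pochhammer (1 / 2) n / fact n"
proof (induction n)
  case 0
  then show ?case by (simp add: sqrt_coeff_0)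
next
  case (Suc n)
  have "(\<Sum>k\<le>Suc n. sqrt_coeff k) = pochhammer (1 / 2) n / fact n + sqrt_coeff (Suc n)"
    by (simp add: Suc.IH)
  also have "pochhammer (1 / 2 :: real) n / fact n
      = ((real n + 1) * pochhammer (1 / 2) n) / fact (Suc n)"
    using nonzero_mult_divide_mult_cancel_left[of "real n + 1" "pochhammer (1 / 2) n" "fact n"]
    by (simp add: add.commute)
  also have "sqrt_coeff (Suc n) = (- 1 / 2 * pochhammer (1 / 2) n) / fact (Suc n)"
    unfolding sqrt_coeff_def pochhammer_rec by simp
  also have "((real n + 1) * pochhammer (1 / 2) n) / fact (Suc n)
      + (- 1 / 2 * pochhammer (1 / 2) n) / fact (Suc n)
      = ((real n + 1) * pochhammer (1 / 2) n + - 1 / 2 * pochhammer (1 / 2) n) / fact (Suc n)"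
    by (rule add_divide_distrib[symmetric])
  also have "(real n + 1) * pochhammer (1 / 2) n + - 1 / 2 * pochhammer (1 / 2) n
      = pochhammer (1 / 2) (Suc n)"
    by (simp add: pochhammer_Suc algebra_simps)
  finally show ?case .
qed

text \<open>From index 1 on all coefficients are nonpositive, so the absolute sum is 1 minus a
  nonnegative partial sum. This gives absolute convergence up to norm 1 and the bound on
  \<open>1 - r\<close> for the root \<open>r\<close>.\<close>

lemma sum_abs_sqrt_coeff_Suc: "(\<Sum>k<n. \<bar>sqrt_coeff (Suc k)\<bar>) \<le> 1"
proof -
  have "(\<Sum>k<n. \<bar>sqrt_coeff (Suc k)\<bar>) = - (\<Sum>k<n. sqrt_coeff (Suc k))"
    using sqrt_coeff_Suc_le_0 by (simp add: abs_of_nonpos sum_negf)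
  also have "\<dots> = 1 - (\<Sum>k\<le>n. sqrt_coeff k)"
    by (simp add: sum.atMost_shift sqrt_coeff_0)
  also have "\<dots> \<le> 1" by (simp add: sum_sqrt_coeff pochhammer_nonneg)
  finally show ?thesis .
qed

text \<open>Chu-Vandermonde with both parameters -1/2: the squared series has the coefficients of 1
  - w, because \<open>pochhammer (- 1) n\<close> vanishes for n >= 2.\<close>

lemma sqrt_coeff_convolution:
  "(\<Sum>i\<le>n. sqrt_coeff i * sqrt_coeff (n - i)) = (if n = 0 then 1 else if n = 1 then - 1 else 0)"
proof -
  have "(\<Sum>i\<le>n. sqrt_coeff i * sqrt_coeff (n - i)) =
      (\<Sum>i\<le>n. of_nat (n choose i) * pochhammer (- 1 / 2) i * pochhammer (- 1 / 2) (n - i)) / fact n"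
    unfolding sum_divide_distrib
    by (intro sum.cong) (auto simp: sqrt_coeff_def binomial_fact field_simps)
  also have "\<dots> = pochhammer (- 1) n / fact n"
    using pochhammer_binomial_sum[of "- 1 / 2 :: real" "- 1 / 2" n] by simp
  also have "pochhammer (- 1 :: real) n = (if n = 0 then 1 else if n = 1 then - 1 else 0)"
    by (cases n; cases "n - 1") (auto simp: pochhammer_rec)
  finally show ?thesis by auto
qed

text \<open>This takes the place of continuous functional calculus. The bound on
  \<open>1 - r\<close> will say that the root is positive, and the commutation clause holds because
  \<open>r\<close> is a norm limit of polynomials in \<open>w\<close>.\<close>

lemma sqrt_one_minus_exists:
  fixes w :: "'a::unital_cstar_algebra"
  assumes w: "norm w \<le> 1" "adj w = w"
  obtains r where "adj r = r" "r * r = 1 - w" "norm (1 - r) \<le> 1"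
    "\<forall>v. v * w = w * v \<longrightarrow> v * r = r * v"
proof
  define c where "c k = sqrt_coeff k *\<^sub>R w ^ k" for k
  define r where "r = suminf c"
  have nc: "norm (c k) \<le> \<bar>sqrt_coeff k\<bar>" for k
  proof -
    have "norm (w ^ k) \<le> 1"
      using w norm_power_ineq[of w k] power_le_one[of "norm w" k] by simp
    then show ?thesis by (simp add: c_def mult_left_le)
  qed
  have sa: "summable (\<lambda>k. \<bar>sqrt_coeff k\<bar>)"
    by (subst summable_Suc_iff[symmetric], rule summableI_nonneg_bounded[of _ 1])
      (auto simp: sum_abs_sqrt_coeff_Suc)
  have sn: "summable (\<lambda>k. norm (c k))"
    by (rule summable_comparison_test'[OF sa, of 0]) (use nc in auto)
  then have s: "summable c" by (rule summable_norm_cancel)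
  have "adj r = (\<Sum>k. adj (c k))"
    unfolding r_def by (rule bounded_linear.suminf[OF bounded_linear_adj s])
  then show "adj r = r" by (simp add: r_def c_def[abs_def] adj_simps w)
  have conv: "(\<Sum>i\<le>n. c i * c (n - i)) = (if n = 0 then 1 else if n = 1 then - w else 0)" for n
  proof -
    have "(\<Sum>i\<le>n. c i * c (n - i)) = (\<Sum>i\<le>n. (sqrt_coeff i * sqrt_coeff (n - i)) *\<^sub>R w ^ n)"
      by (intro sum.cong) (auto simp: c_def power_add[symmetric])
    also have "\<dots> = (if n = 0 then 1 else if n = 1 then - 1 else 0) *\<^sub>R w ^ n"
      by (simp only: scaleR_sum_left[symmetric] sqrt_coeff_convolution)
    finally show ?thesis by auto
  qed
  have "r * r = (\<Sum>n. \<Sum>i\<le>n. c i * c (n - i))"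
    unfolding r_def by (rule Cauchy_product[OF sn sn])
  also have "\<dots> = (\<Sum>n\<in>{0,1::nat}. if n = 0 then 1 else if n = 1 then - w else 0)"
    unfolding conv by (rule suminf_finite) auto
  finally show "r * r = 1 - w" by simp
  have sn': "summable (\<lambda>k. norm (c (Suc k)))" using sn by (subst summable_Suc_iff)
  have "r = 1 + (\<Sum>k. c (Suc k))"
    using suminf_split_head[OF s] by (simp add: r_def c_def sqrt_coeff_0)
  then have "norm (1 - r) = norm (\<Sum>k. c (Suc k))" by simp
  also have "\<dots> \<le> (\<Sum>k. norm (c (Suc k)))" by (rule summable_norm[OF sn'])
  also have "\<dots> \<le> 1"
  proof (rule suminf_le_const[OF sn'])
    fix n show "(\<Sum>k<n. norm (c (Suc k))) \<le> 1"
      using sum_mono[of "{..<n}" "\<lambda>k. norm (c (Suc k))" "\<lambda>k. \<bar>sqrt_coeff (Suc k)\<bar>"] nc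
        sum_abs_sqrt_coeff_Suc[of n] by (meson order_trans)
  qed
  finally show "norm (1 - r) \<le> 1" .
  show "\<forall>v. v * w = w * v \<longrightarrow> v * r = r * v"
  proof (intro allI impI)
    fix v assume v: "v * w = w * v"
    have "v * w ^ k = w ^ k * v" for k using power_commuting_commutes[of w v k] v by simp
    then show "v * r = r * v"
      by (simp add: r_def suminf_mult[OF s, symmetric] suminf_mult2[OF s] c_def)
  qed
qed

text \<open>For self-adjoint \<open>x\<close> the condition says that the spectrum lies in [0, 2s].
  This form makes sums of positive elements positive by the triangle inequality; that it describes
  exactly the elements \<open>adj y * y\<close> is the far harder \<open>pos_iff\<close>.\<close>

definition pos :: "'a::unital_cstar_algebra \<Rightarrow> bool"
  where "pos x \<longleftrightarrow> adj x = x \<and> (\<exists>s. norm (s *\<^sub>R 1 - x) \<le> s)"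

lemma pos_adj: "pos x \<Longrightarrow> adj x = x"
  by (simp add: pos_def)

lemma pos_add: "pos x \<Longrightarrow> pos y \<Longrightarrow> pos (x + y)"
proof -
  assume x: "pos x" and y: "pos y"
  then obtain s t where "norm (s *\<^sub>R 1 - x) \<le> s" "norm (t *\<^sub>R 1 - y) \<le> t" by (auto simp: pos_def)
  then have "norm ((s + t) *\<^sub>R 1 - (x + y)) \<le> s + t"
    using norm_triangle_ineq[of "s *\<^sub>R 1 - x" "t *\<^sub>R 1 - y"] by (simp add: algebra_simps)
  then show ?thesis using x y by (auto simp: pos_def adj_simps)
qed

lemma pos_scaleR: "pos x \<Longrightarrow> c \<ge> 0 \<Longrightarrow> pos (c *\<^sub>R x)"
proof -
  assume x: "pos x" and c: "c \<ge> 0"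
  then obtain s where s: "norm (s *\<^sub>R 1 - x) \<le> s" by (auto simp: pos_def)
  have "norm ((c * s) *\<^sub>R 1 - c *\<^sub>R x) = c * norm (s *\<^sub>R 1 - x)"
    using c norm_scaleR[of c "s *\<^sub>R 1 - x"] by (simp add: scaleR_right_diff_distrib)
  then have "norm ((c * s) *\<^sub>R 1 - c *\<^sub>R x) \<le> c * s" using s c by (simp add: mult_left_mono)
  then show ?thesis using x by (auto simp: pos_def adj_simps)
qed

lemma pos_of_real_iff: "pos (c *\<^sub>R 1 :: 'a::unital_cstar_algebra) \<longleftrightarrow> c \<ge> 0"
proof -
  have "norm (s *\<^sub>R 1 - c *\<^sub>R (1::'a)) = \<bar>s - c\<bar>" for s
    by (metis norm_one mult.right_neutral norm_scaleR scaleR_left_diff_distrib)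
  then show ?thesis by (auto simp: pos_def adj_simps intro: exI[of _ c])
qed

lemma pos_0: "pos 0" and pos_1: "pos 1"
  using pos_of_real_iff[of 0] pos_of_real_iff[of 1] by simp_all

lemma pos_norm_plus: "adj x = x \<Longrightarrow> pos (norm x *\<^sub>R 1 + x)"
  and pos_norm_minus: "adj x = x \<Longrightarrow> pos (norm x *\<^sub>R 1 - x)"
  by (auto simp: pos_def adj_simps intro!: exI[of _ "norm x"])

text \<open>\<open>1 - h\<^sup>2 = r\<^sup>2\<close> for the imaginary part \<open>r\<close> of a unitary \<open>h + i r\<close>.\<close>

lemma norm_one_minus_square:
  assumes h: "adj h = h" "norm h \<le> 1"
  shows "norm (1 - h * h) \<le> 1"
proof -
  have "norm (h * h) \<le> 1" using h by (simp add: norm_square_selfadj power_le_one)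
  moreover have "adj (h * h) = h * h" using h by (simp add: adj_simps)
  ultimately obtain r where r: "adj r = r" "r * r = 1 - h * h"
    and comm: "\<forall>v. v * (h * h) = (h * h) * v \<longrightarrow> v * r = r * v"
    by (rule sqrt_one_minus_exists) (rule that)
  have hr: "h * r = r * h" using spec[OF comm, of h] by (simp add: mult.assoc)
  define u where "u = h + \<i> *\<^sub>C r"
  have adju: "adj u = h - \<i> *\<^sub>C r" by (simp add: u_def adj_simps h r)
  have "adj u * u = 1"
    unfolding adju by (simp add: u_def algebra_simps mult_scaleC_left mult_scaleC_right
        scaleC_scaleC hr r scaleC_add_right cvec.scale_right_diff_distrib)
  then have "norm u = 1" using norm_adj_mult_self[of u] norm_ge_zero[of u]
    by (auto simp: power2_eq_1_iff simp del: norm_ge_zero)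
  have "norm (u - adj u) \<le> 2"
    using norm_triangle_ineq4[of u "adj u"] \<open>norm u = 1\<close> by (simp add: norm_adj)
  moreover have "u - adj u = (2 * \<i>) *\<^sub>C r"
    unfolding adju by (simp add: u_def algebra_simps scaleC_add_left[symmetric])
  ultimately have "norm r \<le> 1" by (simp add: norm_scaleC norm_mult)
  then show ?thesis using r norm_square_selfadj[of r] by (simp add: power_le_one)
qed

lemma norm_diff_square_le:
  fixes h :: "'a::unital_cstar_algebra"
  assumes h: "adj h = h" and s: "(norm h)\<^sup>2 \<le> s"
  shows "norm (s *\<^sub>R 1 - h * h) \<le> s"
proof (cases "s = 0")
  case True
  then show ?thesis using s by simp
next
  case False
  then have s0: "s > 0" using s by (smt (verit) zero_le_power2)
  define k where "k = (1 / sqrt s) *\<^sub>R h"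
  have "norm h \<le> sqrt s" using s by (simp add: real_le_rsqrt)
  then have "norm (1 - k * k) \<le> 1"
    using s0 h by (intro norm_one_minus_square) (auto simp: k_def adj_simps)
  then have "norm (s *\<^sub>R (1 - k * k)) \<le> s" using s0 by simp
  moreover have "s *\<^sub>R (1 - k * k) = s *\<^sub>R 1 - h * h"
    using s0 by (simp add: k_def scaleR_right_diff_distrib)
  ultimately show ?thesis by simp
qed

lemma pos_square: "adj h = h \<Longrightarrow> pos (h * h)"
  unfolding pos_def using norm_diff_square_le[of h "(norm h)\<^sup>2"] by (auto simp: adj_simps)

text \<open>The witness \<open>s\<close> of positivity makes w = 1 - x/s a contraction, so a root of
  1 - w, scaled by sqrt s, is a root of x.\<close>

lemma pos_sqrt:
  assumes x: "pos x"
  obtains h where "pos h" "h * h = x" "\<forall>v. v * x = x * v \<longrightarrow> v * h = h * v"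
proof -
  obtain s where s: "norm (s *\<^sub>R 1 - x) \<le> s" using x by (auto simp: pos_def)
  show thesis
  proof (cases "s = 0")
    case True
    then have "x = 0" using s by simp
    then show thesis by (intro that[of 0]) (auto simp: pos_0)
  next
    case False
    then have s0: "s > 0" using s norm_ge_zero[of "s *\<^sub>R 1 - x"] by linarith
    define w where "w = 1 - (1 / s) *\<^sub>R x"
    have "w = (1 / s) *\<^sub>R (s *\<^sub>R 1 - x)" using s0 by (simp add: w_def scaleR_right_diff_distrib)
    then have "norm w \<le> 1" using s s0 by simp
    moreover have "adj w = w" using x by (simp add: w_def adj_simps pos_def)
    ultimately obtain r where r: "adj r = r" "r * r = 1 - w" "norm (1 - r) \<le> 1"
      "\<forall>v. v * w = w * v \<longrightarrow> v * r = r * v"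
      by (rule sqrt_one_minus_exists)
    show thesis
    proof (rule that[of "sqrt s *\<^sub>R r"])
      have "pos r" using r(1,3) by (auto simp: pos_def intro!: exI[of _ 1])
      then show "pos (sqrt s *\<^sub>R r)" using s0 by (intro pos_scaleR) auto
      show "(sqrt s *\<^sub>R r) * (sqrt s *\<^sub>R r) = x" using s0 r(2) by (simp add: w_def)
      show "\<forall>v. v * x = x * v \<longrightarrow> v * sqrt s *\<^sub>R r = sqrt s *\<^sub>R r * v"
      proof (intro allI impI)
        fix v assume "v * x = x * v"
        then have "v * w = w * v" by (simp add: w_def algebra_simps)
        then have "v * r = r * v" using spec[OF r(4), of v] by blast
        then show "v * sqrt s *\<^sub>R r = sqrt s *\<^sub>R r * v" by simp
      qed
    qed
  qed
qed

text \<open>Passing through a square root improves the existential witness in \<open>pos\<close> to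
  every \<open>s\<close> that is at least the norm.\<close>

lemma pos_norm_diff_le:
  assumes x: "pos x" and s: "norm x \<le> s"
  shows "norm (s *\<^sub>R 1 - x) \<le> s"
proof -
  obtain h where "pos h" "h * h = x" by (rule pos_sqrt[OF x])
  then show ?thesis
    using s norm_diff_square_le[of h s] norm_square_selfadj[of h] by (auto simp: pos_adj)
qed

lemma pos_power: "pos x \<Longrightarrow> pos (x ^ n)"
proof -
  assume "pos x"
  then obtain h where h: "pos h" "h * h = x" by (rule pos_sqrt)
  have "x ^ n = h ^ (2 * n)" by (simp add: power_mult power2_eq_square h(2))
  then have "x ^ n = h ^ n * h ^ n" by (simp add: mult_2 power_add)
  then show ?thesis using pos_square[of "h ^ n"] h by (simp add: adj_simps pos_adj)
qed

text \<open>The optimal constant is \<open>1\<close>; a cruder one suffices here and follows from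
  \<open>4 n x = (n + x)\<^sup>2 - (n - x)\<^sup>2\<close> with \<open>n = \<parallel>x\<parallel>\<close>.\<close>

lemma norm_le_of_order_bounds:
  assumes p: "pos (t *\<^sub>R 1 + x)" and m: "pos (t *\<^sub>R 1 - x)"
  shows "norm x \<le> 3 * t"
proof -
  define n where "n = norm x"
  have "pos ((2 * t) *\<^sub>R (1::'a))"
    using pos_add[OF p m] by (simp add: scaleR_2[symmetric])
  then have t: "t \<ge> 0" by (simp add: pos_of_real_iff)
  have "norm (t *\<^sub>R 1 - x) \<le> n + t" "norm (t *\<^sub>R 1 + x) \<le> n + t"
    using norm_triangle_ineq4[of "t *\<^sub>R 1" x] norm_triangle_ineq[of "t *\<^sub>R 1" x] t
    by (auto simp: n_def)
  then have "norm ((n + t) *\<^sub>R 1 - (t *\<^sub>R 1 - x)) \<le> n + t"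
    "norm ((n + t) *\<^sub>R 1 - (t *\<^sub>R 1 + x)) \<le> n + t"
    using pos_norm_diff_le[OF m] pos_norm_diff_le[OF p] by auto
  then have u: "norm (n *\<^sub>R 1 + x) \<le> n + t" and v: "norm (n *\<^sub>R 1 - x) \<le> n + t"
    by (auto simp: algebra_simps)
  have "(4 * n) *\<^sub>R x = (n *\<^sub>R 1 + x) * (n *\<^sub>R 1 + x) - (n *\<^sub>R 1 - x) * (n *\<^sub>R 1 - x)"
    by (simp add: algebra_simps) (simp flip: scaleR_add_left)
  then have "norm ((4 * n) *\<^sub>R x) =
      norm ((n *\<^sub>R 1 + x) * (n *\<^sub>R 1 + x) - (n *\<^sub>R 1 - x) * (n *\<^sub>R 1 - x))" by simp
  also have "\<dots> \<le>
      norm (n *\<^sub>R 1 + x) * norm (n *\<^sub>R 1 + x) + norm (n *\<^sub>R 1 - x) * norm (n *\<^sub>R 1 - x)"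
    using norm_triangle_ineq4[of "(n *\<^sub>R 1 + x) * (n *\<^sub>R 1 + x)" "(n *\<^sub>R 1 - x) * (n *\<^sub>R 1 - x)"]
      norm_mult_ineq[of "n *\<^sub>R 1 + x" "n *\<^sub>R 1 + x"]
      norm_mult_ineq[of "n *\<^sub>R 1 - x" "n *\<^sub>R 1 - x"] by linarith
  also have "\<dots> \<le> (n + t) * (n + t) + (n + t) * (n + t)"
    using u v by (intro add_mono mult_mono) (auto simp: n_def t)
  finally have le: "4 * n * n \<le> 2 * ((n + t) * (n + t))" by (simp add: n_def)
  show ?thesis
  proof (rule ccontr)
    assume "\<not> norm x \<le> 3 * t"
    then have nt: "3 * t < n" by (simp add: n_def)
    \<comment> \<open>If n > 3 t, the right-hand side of \<open>le\<close> is at most (32/9) n^2,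
      less than 4 n^2. The estimate would allow the constant 1 + sqrt 2; 3 is the next
      integer.\<close>
    then have "(n + t) * (n + t) \<le> (4 / 3 * n) * (4 / 3 * n)"
      using t by (intro mult_mono) auto
    then have "n * n \<le> 0" using le by (simp add: field_simps)
    moreover have "n * n > 0" using nt t by (intro mult_pos_pos) auto
    ultimately show False by simp
  qed
qed

lemma norm_mono_pos:
  assumes a: "pos a" and ba: "pos (b - a)"
  shows "norm a \<le> 3 * norm b"
proof (rule norm_le_of_order_bounds)
  have "adj b = b" using pos_adj[OF pos_add[OF a ba]] by simp
  then have b: "pos (norm b *\<^sub>R 1 - b)" by (rule pos_norm_minus)
  show "pos (norm b *\<^sub>R 1 - a)" using pos_add[OF b ba] by simp
  have "pos (norm b *\<^sub>R (1::'a))" by (simp add: pos_of_real_iff)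
  then show "pos (norm b *\<^sub>R 1 + a)" using pos_add a by blast
qed

section \<open>Real and imaginary parts\<close>

definition rpart :: "'a::unital_cstar_algebra \<Rightarrow> 'a"
  where "rpart x = (1 / 2) *\<^sub>R (x + adj x)"

definition ipart :: "'a::unital_cstar_algebra \<Rightarrow> 'a"
  where "ipart x = (- \<i> / 2) *\<^sub>C (x - adj x)"

lemma scaleR_scaleC: "r *\<^sub>R x = complex_of_real r *\<^sub>C x"
  by (simp add: scaleC_of_real)

lemma scaleC_minus_ii: "(- (\<i> / 2)) *\<^sub>C x = - ((\<i> / 2) *\<^sub>C x)"
  by (rule cvec.scale_minus_left)

lemma adj_rpart: "adj (rpart x) = rpart x"
  by (simp add: rpart_def adj_simps add.commute)

lemma adj_ipart: "adj (ipart x) = ipart x"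
  by (simp add: ipart_def adj_simps scaleC_minus_ii cvec.scale_right_diff_distrib)

lemma rpart_ipart: "rpart x + \<i> *\<^sub>C ipart x = x"
proof -
  have "\<i> *\<^sub>C ipart x = (1 / 2) *\<^sub>C (x - adj x)"
    by (simp add: ipart_def scaleC_scaleC)
  moreover have "rpart x = (1 / 2) *\<^sub>C (x + adj x)"
    by (simp add: rpart_def scaleR_scaleC)
  moreover have "(1 / 2) *\<^sub>C (x + adj x) + (1 / 2) *\<^sub>C (x - adj x) = (1 / 2) *\<^sub>C (x + x)"
    by (simp add: scaleC_add_right[symmetric])
  moreover have "(1 / 2) *\<^sub>C (x + x) = x"
    by (simp add: scaleC_add_right scaleC_add_left[symmetric])
  ultimately show ?thesis by simp
qed

lemma rpart_add: "rpart (x + y) = rpart x + rpart y"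
  and ipart_add: "ipart (x + y) = ipart x + ipart y"
  by (simp_all add: rpart_def ipart_def adj_simps algebra_simps scaleC_add_right
      cvec.scale_right_diff_distrib)

lemma rpart_scaleR: "rpart (r *\<^sub>R x) = r *\<^sub>R rpart x"
  by (simp add: rpart_def adj_simps algebra_simps)

lemma rpart_selfadj: "adj x = x \<Longrightarrow> rpart x = x"
  and ipart_selfadj: "adj x = x \<Longrightarrow> ipart x = 0"
  by (simp_all add: rpart_def ipart_def scaleR_2[symmetric])

lemma norm_rpart: "norm (rpart x) \<le> norm x"
  using norm_triangle_ineq[of x "adj x"] by (simp add: rpart_def norm_adj)

lemma norm_ipart: "norm (ipart x) \<le> norm x"
  using norm_triangle_ineq4[of x "adj x"] by (simp add: ipart_def norm_adj norm_scaleC norm_divide)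

lemma rpart_ii: "rpart (\<i> *\<^sub>C x) = - ipart x"
  and ipart_ii: "ipart (\<i> *\<^sub>C x) = rpart x"
proof -
  show "rpart (\<i> *\<^sub>C x) = - ipart x"
    by (simp add: rpart_def ipart_def adj_simps scaleR_scaleC scaleC_scaleC scaleC_add_right
        cvec.scale_right_diff_distrib scaleC_minus_ii)
  show "ipart (\<i> *\<^sub>C x) = rpart x"
    by (simp add: rpart_def ipart_def adj_simps scaleR_scaleC scaleC_scaleC scaleC_add_right
        cvec.scale_right_diff_distrib)
qed

lemma ipart_scaleR: "ipart (r *\<^sub>R x) = r *\<^sub>R ipart x"
  by (simp add: ipart_def adj_simps scaleR_scaleC scaleC_scaleC mult.commute
      flip: cvec.scale_right_diff_distrib)

lemma scaleC_Re_Im: "c *\<^sub>C x = Re c *\<^sub>R x + Im c *\<^sub>R (\<i> *\<^sub>C x)"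
  by (subst complex_eq[of c]) (simp add: scaleC_add_left scaleR_scaleC scaleC_scaleC mult.commute)

text \<open>\<open>z z\<^sup>* = 2 a\<^sup>2 + 2 b\<^sup>2 - z\<^sup>* z\<close> for \<open>z = a + i b\<close>.\<close>

lemma pos_mult_adj_if_pos_minus:
  assumes "pos (- (adj z * z))"
  shows "pos (z * adj z)"
proof -
  define a b where "a = rpart z" and "b = ipart z"
  have sa: "adj a = a" "adj b = b" by (simp_all add: a_def b_def adj_rpart adj_ipart)
  have z: "z = a + \<i> *\<^sub>C b" by (simp add: a_def b_def rpart_ipart)
  have adjz: "adj z = a - \<i> *\<^sub>C b" unfolding z by (simp add: adj_simps sa)
  have "z * adj z + adj z * z = 2 *\<^sub>R (a * a + b * b)"
    unfolding adjz unfolding z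
    by (simp add: algebra_simps mult_scaleC_left mult_scaleC_right scaleC_scaleC scaleR_2)
  then have "z * adj z = 2 *\<^sub>R (a * a + b * b) + - (adj z * z)"
    by (metis add_diff_cancel diff_conv_add_uminus)
  then show ?thesis using assms sa by (simp only:) (intro pos_add pos_scaleR pos_square; simp)
qed

text \<open>With \<open>p = z z\<^sup>*\<close> and \<open>q = - z\<^sup>* z\<close> both positive of norm \<open>1\<close>, the intertwining relation
  \<open>(1 - p)\<^sup>4 z = z (1 + q)\<^sup>4\<close> bounds the norm of \<open>q (1 + q)\<^sup>4 \<ge> 4 q\<^sup>2\<close> by \<open>1\<close>, a contradiction.\<close>

lemma eq_0_if_pos_minus_normalized:
  assumes q: "pos (- (adj z * z))" and z: "norm z = 1"
  shows False
proof -
  define p where "p = z * adj z"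
  define q' where "q' = - (adj z * z)"
  have pq: "pos p" "pos q'" using q pos_mult_adj_if_pos_minus by (auto simp: p_def q'_def)
  have "norm (adj z * z) = 1" using z by (simp add: norm_adj_mult_self)
  then have nq: "norm q' = 1" by (simp add: q'_def)
  have "norm p = 1" using norm_adj_mult_self[of "adj z"] z by (simp add: p_def adj_adj norm_adj)
  then have n1p: "norm (1 - p) \<le> 1" using pos_norm_diff_le[OF pq(1), of 1] by simp
  have comm: "(1 - p) * z = z * (1 + q')" by (simp add: p_def q'_def algebra_simps)
  have comm_n: "(1 - p) ^ n * z = z * (1 + q') ^ n" for n
  proof (induction n)
    case (Suc n)
    have "(1 - p) ^ Suc n * z = (1 - p) * ((1 - p) ^ n * z)" by (simp add: mult.assoc)
    also have "\<dots> = ((1 - p) * z) * (1 + q') ^ n" by (simp add: Suc.IH mult.assoc)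
    also have "\<dots> = z * (1 + q') ^ Suc n" by (simp only: comm) (simp add: mult.assoc)
    finally show ?case .
  qed simp
  have "q' * (1 + q') ^ 4 = - (adj z * ((1 - p) ^ 4 * z))"
    by (simp only: comm_n) (simp add: q'_def mult.assoc)
  then have "norm (q' * (1 + q') ^ 4) = norm (adj z * ((1 - p) ^ 4 * z))" by simp
  also have "\<dots> \<le> norm (adj z) * norm ((1 - p) ^ 4 * z)" by (rule norm_mult_ineq)
  also have "\<dots> \<le> norm ((1 - p) ^ 4) * norm z"
    using norm_mult_ineq[of "(1 - p) ^ 4" z] z by (simp add: norm_adj)
  also have "\<dots> \<le> 1"
    using norm_power_ineq[of "1 - p" 4] power_le_one[OF norm_ge_zero n1p, of 4] z by simp
  finally have le1: "norm (q' * (1 + q') ^ 4) \<le> 1" .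
  have s4: "4 *\<^sub>R v = 2 *\<^sub>R 2 *\<^sub>R v" and s6: "6 *\<^sub>R v = 4 *\<^sub>R v + 2 *\<^sub>R v" for v :: 'a
    by (simp_all flip: scaleR_add_left)
  have "q' * (1 + q') ^ 4 - 4 *\<^sub>R q' ^ 2
      = q' + (6 *\<^sub>R q' ^ 3 + (4 *\<^sub>R q' ^ 4 + q' ^ 5))"
    unfolding s6 s4 scaleR_2 by (simp add: eval_nat_numeral algebra_simps)
  then have "pos (q' * (1 + q') ^ 4 - 4 *\<^sub>R q' ^ 2)"
    using pq(2) by (simp only:) (intro pos_add pos_scaleR pos_power; simp)
  moreover have "pos (4 *\<^sub>R q' ^ 2)" using pq(2) by (intro pos_scaleR pos_power) auto
  \<comment> \<open>The exponent 4 is dictated by the factor 3 of \<open>norm_mono_pos\<close>: an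
    exponent n gives the coefficient n in front of the square of q', and n > 3 is needed for the
    contradiction 4 \<le> 3.\<close>
  ultimately have "norm (4 *\<^sub>R q' ^ 2) \<le> 3 * norm (q' * (1 + q') ^ 4)"
    by (intro norm_mono_pos)
  moreover have "norm (q' ^ 2) = 1"
    using norm_square_selfadj[of q'] pos_adj[OF pq(2)] nq by (simp add: power2_eq_square)
  ultimately show False using le1 by simp
qed

lemma eq_0_if_pos_minus:
  assumes q: "pos (- (adj z * z))"
  shows "z = 0"
proof (rule ccontr)
  assume z: "z \<noteq> 0"
  define c where "c = 1 / norm z"
  have "- (adj (c *\<^sub>R z) * (c *\<^sub>R z)) = (c * c) *\<^sub>R (- (adj z * z))" by (simp add: adj_simps)
  then have "pos (- (adj (c *\<^sub>R z) * (c *\<^sub>R z)))"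
    using q by (simp only:) (intro pos_scaleR; simp)
  moreover have "norm (c *\<^sub>R z) = 1" using z by (simp add: c_def)
  ultimately show False by (rule eq_0_if_pos_minus_normalized)
qed

text \<open>With \<open>m = \<bar>x\<bar>\<close> for \<open>x = y\<^sup>* y\<close>, the element \<open>n = m - x\<close> is twice the negative part of \<open>x\<close>,
  and \<open>(y n)\<^sup>* (y n) = n x n = - n m n \<le> 0\<close>.\<close>

theorem pos_adj_mult: "pos (adj y * y)"
proof -
  define x where "x = adj y * y"
  have x: "adj x = x" by (simp add: x_def adj_simps)
  obtain m where m: "pos m" "m * m = x * x" and mc: "\<forall>v. v * (x * x) = (x * x) * v \<longrightarrow> v * m = m * v"
    by (rule pos_sqrt[OF pos_square[OF x]])
  \<comment> \<open>A root of m that commutes with n exhibits n m n as the square of the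
    self-adjoint k n.\<close>
  obtain k where k: "pos k" "k * k = m" and kc: "\<forall>v. v * m = m * v \<longrightarrow> v * k = k * v"
    by (rule pos_sqrt[OF m(1)])
  have xm: "x * m = m * x" using spec[OF mc, of x] by (simp add: mult.assoc)
  define n where "n = m - x"
  have n: "adj n = n" using x pos_adj[OF m(1)] by (simp add: n_def adj_simps)
  have nm: "n * m = m * n" by (simp add: n_def algebra_simps xm)
  have nk: "n * k = k * n" using spec[OF kc, of n] nm by simp
  have xn: "x * n = - (m * n)" by (simp add: n_def algebra_simps xm m)
  have "adj (y * n) * (y * n) = n * (x * n)" by (simp add: adj_simps n x_def mult.assoc)
  also have "\<dots> = - (n * m * n)" by (simp add: xn mult.assoc)
  finally have zz: "adj (y * n) * (y * n) = - (n * m * n)" .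
  have "n * m * n = (k * n) * (k * n)"
  proof -
    have "n * m * n = (n * k) * (k * n)" by (simp add: mult.assoc flip: k(2))
    then show ?thesis by (simp only: nk)
  qed
  moreover have "adj (k * n) = k * n" using pos_adj[OF k(1)] by (simp add: adj_simps n nk)
  ultimately have "pos (n * m * n)" using pos_square[of "k * n"] by simp
  then have "y * n = 0" using eq_0_if_pos_minus[of "y * n"] zz by simp
  then have nmn: "n * m * n = 0" using zz by simp
  \<comment> \<open>From n^2 = 2 m n and n m n = 0 follows n^3 = 0, hence n^4 = 0, and the norm
    identity for self-adjoint squares, applied twice, gives n = 0, that is x = m.\<close>
  have nn: "n * n = 2 *\<^sub>R (m * n)" by (simp add: n_def algebra_simps xm m scaleR_2)
  have "n * (n * n) = 2 *\<^sub>R (n * m * n)" unfolding nn by (simp add: mult.assoc)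
  then have "(n * n) * (n * n) = 0" using nmn by (simp add: mult.assoc)
  moreover have "adj (n * n) = n * n" by (simp add: adj_simps n)
  ultimately have "n * n = 0" using norm_square_selfadj[of "n * n"] by simp
  then have "n = 0" using norm_square_selfadj[OF n] by simp
  then show ?thesis using m by (simp add: n_def x_def)
qed

text \<open>Square roots give one direction and \<open>pos_adj_mult\<close> the other; from here on
  the metric cone and the squares in \<open>state\<close> and in 1 by 1 \<open>mat_positive\<close>
  are interchangeable.\<close>

lemma pos_iff: "pos x \<longleftrightarrow> (\<exists>y. x = adj y * y)"
proof
  assume x: "pos x"
  obtain h where "pos h" "h * h = x" by (rule pos_sqrt[OF x])
  then have "x = adj h * h" by (simp add: pos_adj)
  then show "\<exists>y. x = adj y * y" by blast
qed (auto simp: pos_adj_mult)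

section \<open>Positive unital maps\<close>

lemma pos_complex_iff: "pos (z :: complex) \<longleftrightarrow> z \<in> \<real>\<^sub>\<ge>\<^sub>0"
proof
  assume "pos z"
  then show "z \<in> \<real>\<^sub>\<ge>\<^sub>0"
    by (auto simp: pos_iff adj_complex_def mult.commute[of "cnj _"] complex_mult_cnj
        complex_nonneg_Reals_iff)
next
  assume "z \<in> \<real>\<^sub>\<ge>\<^sub>0"
  then obtain r where "z = complex_of_real r" "r \<ge> 0" by (auto elim: nonneg_Reals_cases)
  then have "z = adj (complex_of_real (sqrt r)) * complex_of_real (sqrt r)"
    by (simp add: adj_complex_def flip: of_real_mult)
  then show "pos z" unfolding pos_iff by blast
qed

text \<open>Common ground of states and ucp maps: a state is the case of values in the C*-algebra of
  complex numbers, so bounds and compatibility with the involution are proved once for both.\<close>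

definition pos_unital :: "('a::unital_cstar_algebra \<Rightarrow> 'b::unital_cstar_algebra) \<Rightarrow> bool"
  where "pos_unital f \<longleftrightarrow> clinear f \<and> (\<forall>x. pos x \<longrightarrow> pos (f x)) \<and> f 1 = 1"

lemma pos_unital_clinear: "pos_unital f \<Longrightarrow> clinear f"
  and pos_unital_pos: "pos_unital f \<Longrightarrow> pos x \<Longrightarrow> pos (f x)"
  and pos_unital_1: "pos_unital f \<Longrightarrow> f 1 = 1"
  by (auto simp: pos_unital_def)

lemma state_iff_pos_unital: "state f \<longleftrightarrow> pos_unital f"
  unfolding state_def pos_unital_def pos_complex_iff[symmetric] by (auto simp: pos_iff)

lemma ucp_imp_pos_unital:
  assumes "ucp T"
  shows "pos_unital T"
  unfolding pos_unital_def
proof (intro conjI allI impI)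
  show "clinear T" "T 1 = 1" using assms by (auto simp: ucp_def completely_positive_def)
  fix x :: 'a assume "pos x"
  then obtain y where "x = adj y * y" by (auto simp: pos_iff)
  then have "mat_positive 1 (\<lambda>_ _. x)" by (auto simp: mat_positive_def)
  then have "mat_positive 1 (\<lambda>_ _. T x)"
    using assms unfolding ucp_def completely_positive_def by blast
  then show "pos (T x)" by (auto simp: mat_positive_def pos_iff)
qed

lemma pos_unital_compose: "pos_unital f \<Longrightarrow> pos_unital g \<Longrightarrow> pos_unital (g \<circ> f)"
  by (auto simp: pos_unital_def clinear_iff)

lemma pos_unital_funpow:
  fixes f :: "'a::unital_cstar_algebra \<Rightarrow> 'a"
  shows "pos_unital f \<Longrightarrow> pos_unital (f ^^ n)"
proof (induction n)
  case 0
  then show ?case by (simp add: pos_unital_def clinear_iff)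
next
  case (Suc n)
  then show ?case using pos_unital_compose[of "f ^^ n" f] by (simp only: funpow.simps)
qed

lemma selfadj_eq_diff_pos:
  assumes "adj x = x"
  obtains a b where "pos a" "pos b" "x = a - b"
  using that[of "norm x *\<^sub>R 1 + x" "norm x *\<^sub>R 1"] pos_norm_plus[OF assms]
  by (simp add: pos_of_real_iff)

lemma positive_adj:
  assumes f: "clinear f" and pos: "\<And>x. pos x \<Longrightarrow> pos (f x)"
  shows "f (adj x) = adj (f x)"
proof -
  have sa: "adj (f h) = f h" if h: "adj h = h" for h
  proof -
    obtain a b where "pos a" "pos b" "h = a - b" by (rule selfadj_eq_diff_pos[OF h])
    then show ?thesis by (simp add: clinear_diff[OF f] adj_diff pos_adj pos)
  qed
  define a b where "a = rpart x" and "b = ipart x"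
  have ab: "adj a = a" "adj b = b" by (simp_all add: a_def b_def adj_rpart adj_ipart)
  have x: "x = a + \<i> *\<^sub>C b" by (simp add: a_def b_def rpart_ipart)
  show ?thesis unfolding x
    by (simp add: adj_simps ab clinear_add[OF f] clinear_minus[OF f] clinear_scaleC[OF f]
        clinear_diff[OF f] sa)
qed

lemma pos_unital_adj: "pos_unital f \<Longrightarrow> f (adj x) = adj (f x)"
  by (rule positive_adj) (simp_all add: pos_unital_clinear pos_unital_pos)

text \<open>Order bounds cost a factor 3 on self-adjoint elements, the splitting into real and
  imaginary parts a factor 2. What matters is that 6 serves all positive unital maps at once, in
  particular all iterates of one map.\<close>

lemma pos_unital_norm_le:
  assumes f: "pos_unital f"
  shows "norm (f x) \<le> 6 * norm x"
proof -
  note lin = pos_unital_clinear[OF f]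
  have sa: "norm (f h) \<le> 3 * norm h" if h: "adj h = h" for h
  proof (rule norm_le_of_order_bounds)
    show "pos (norm h *\<^sub>R 1 + f h)"
      using pos_unital_pos[OF f pos_norm_plus[OF h]]
      by (simp add: clinear_add[OF lin] clinear_scaleR[OF lin] pos_unital_1[OF f])
    show "pos (norm h *\<^sub>R 1 - f h)"
      using pos_unital_pos[OF f pos_norm_minus[OF h]]
      by (simp add: clinear_diff[OF lin] clinear_scaleR[OF lin] pos_unital_1[OF f])
  qed
  have "f x = f (rpart x) + \<i> *\<^sub>C f (ipart x)"
    by (metis rpart_ipart clinear_add[OF lin] clinear_scaleC[OF lin])
  then have "norm (f x) \<le> norm (f (rpart x)) + norm (f (ipart x))"
    using norm_triangle_ineq[of "f (rpart x)" "\<i> *\<^sub>C f (ipart x)"] by (simp add: norm_scaleC)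
  also have "\<dots> \<le> 3 * norm x + 3 * norm x"
    using sa[OF adj_rpart, of x] sa[OF adj_ipart, of x] norm_rpart[of x] norm_ipart[of x]
    by linarith
  finally show ?thesis by simp
qed

lemma pos_unital_bounded_linear: "pos_unital f \<Longrightarrow> bounded_linear f"
  using pos_unital_norm_le[of f]
  by (intro bounded_linear_intro[of _ 6])
    (auto simp: clinear_add clinear_scaleR pos_unital_clinear mult.commute)

lemma state_in_cdual: "state f \<Longrightarrow> f \<in> cdual"
  by (auto simp: state_iff_pos_unital cdual_def pos_unital_clinear pos_unital_bounded_linear)

lemma state_adj: "state f \<Longrightarrow> f (adj x) = cnj (f x)"
  using pos_unital_adj[of f] by (simp add: state_iff_pos_unital adj_complex_def)

section \<open>Functionals as combinations of states\<close>

text \<open>A real functional \<open>g\<close> is restricted to the self-adjoint elements and then extended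
  complex-linearly.\<close>

definition cext :: "('a::unital_cstar_algebra \<Rightarrow> real) \<Rightarrow> 'a \<Rightarrow> complex"
  where "cext g x = Complex (g (rpart x)) (g (ipart x))"

lemma clinear_complexI:
  assumes "\<And>x y. f (x + y) = f x + f y" "\<And>c x. f (c *\<^sub>C x) = c * f x"
  shows "clinear (f :: 'a::unital_cstar_algebra \<Rightarrow> complex)"
  using assms by (simp add: clinear_iff scaleC_complex_def)

lemma clinear_scaleC_complex:
  "clinear f \<Longrightarrow> f (c *\<^sub>C x) = c * (f x :: complex)"
  by (simp add: clinear_scaleC scaleC_complex_def)

lemma clinear_cext:
  fixes g :: "'a::unital_cstar_algebra \<Rightarrow> real"
  assumes g: "linear g"
  shows "clinear (cext g)"
proof (rule clinear_complexI)
  show "cext g (x + y) = cext g x + cext g y" for x y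
    by (simp add: cext_def rpart_add ipart_add linear_add[OF g] complex_eq_iff)
  fix c :: complex and x :: 'a
  have "rpart (c *\<^sub>C x) = Re c *\<^sub>R rpart x - Im c *\<^sub>R ipart x"
    "ipart (c *\<^sub>C x) = Re c *\<^sub>R ipart x + Im c *\<^sub>R rpart x"
    unfolding scaleC_Re_Im[of c x] rpart_add ipart_add rpart_scaleR ipart_scaleR rpart_ii ipart_ii
    by simp_all
  then show "cext g (c *\<^sub>C x) = c * cext g x"
    by (simp add: cext_def linear_add[OF g] linear_diff[OF g] linear_scale[OF g] complex_eq_iff)
qed

lemma cext_selfadj:
  assumes "linear g" "adj x = x"
  shows "cext g x = complex_of_real (g x)"
  using assms by (simp add: cext_def rpart_selfadj ipart_selfadj linear_0 complex_of_real_def)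

lemma cext_pos:
  assumes "linear g" "pos x" "g x \<ge> 0"
  shows "pos (cext g x)"
  using assms by (simp add: cext_selfadj pos_adj pos_complex_iff)

lemma state_cext:
  assumes g: "linear g" and pos: "\<And>x. pos x \<Longrightarrow> g x \<ge> 0" and "g 1 = 1"
  shows "state (cext g)"
  unfolding state_iff_pos_unital pos_unital_def
  using assms by (auto simp: clinear_cext cext_pos cext_selfadj adj_1)

text \<open>The value at 1 controls everything: if it is zero, the order bounds of a self-adjoint h
  by multiples of 1 make both f(h) and -f(h) nonnegative; otherwise division by it gives a
  state.\<close>

lemma positive_functional_cases:
  fixes f :: "'a::unital_cstar_algebra \<Rightarrow> complex"
  assumes f: "clinear f" and "\<forall>x. pos x \<longrightarrow> pos (f x)"
  obtains "f = (\<lambda>_. 0)" | c \<omega> where "state \<omega>" "f = (\<lambda>x. c * \<omega> x)"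
proof -
  have pos: "pos (f x)" if "pos x" for x using assms(2) that by blast
  show thesis
  proof (cases "f 1 = 0")
    case True
    have sa: "f h = 0" if h: "adj h = h" for h
    proof -
      have "f (norm h *\<^sub>R 1 + h) = f h" "f (norm h *\<^sub>R 1 - h) = - f h"
        by (simp_all add: clinear_add[OF f] clinear_diff[OF f] clinear_scaleR[OF f] True)
      then have "f h \<in> \<real>\<^sub>\<ge>\<^sub>0" "- f h \<in> \<real>\<^sub>\<ge>\<^sub>0"
        using pos[OF pos_norm_plus[OF h]] pos[OF pos_norm_minus[OF h]]
        by (simp_all add: pos_complex_iff)
      then show ?thesis by (auto simp: complex_nonneg_Reals_iff complex_eq_iff)
    qed
    have "f x = 0" for x
      using sa[OF adj_rpart, of x] sa[OF adj_ipart, of x]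
      by (metis rpart_ipart clinear_add[OF f] clinear_scaleC_complex[OF f] add_0 mult_zero_right)
    then show thesis by (intro that(1)) auto
  next
    case False
    have "f 1 \<in> \<real>\<^sub>\<ge>\<^sub>0" using pos[OF pos_1] by (simp add: pos_complex_iff)
    then obtain r where r: "f 1 = complex_of_real r" "r > 0"
      using False by (metis nonneg_Reals_cases less_eq_real_def of_real_0)
    define \<omega> where "\<omega> x = inverse (complex_of_real r) * f x" for x
    have "clinear \<omega>"
      by (rule clinear_complexI)
        (simp_all add: \<omega>_def clinear_add[OF f] clinear_scaleC_complex[OF f] algebra_simps)
    moreover have "\<omega> x \<in> \<real>\<^sub>\<ge>\<^sub>0" if x: "pos x" for x
      unfolding \<omega>_def using pos[OF x] r
      by (intro nonneg_Reals_mult_I) (auto simp: pos_complex_iff simp flip: of_real_inverse)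
    ultimately have "state \<omega>"
      using r by (simp add: state_iff_pos_unital pos_unital_def pos_complex_iff \<omega>_def)
    moreover have "f = (\<lambda>x. complex_of_real r * \<omega> x)" using r by (auto simp: \<omega>_def)
    ultimately show thesis by (rule that(2))
  qed
qed

text \<open>If \<open>g \<le> q\<close> for the sublinear \<open>q(v) = inf {t M - f(b) | b \<ge> 0, v + b \<le> t 1}\<close>, then
  \<open>g(-b) \<le> q(-b) \<le> min 0 (-f(b))\<close> for \<open>b \<ge> 0\<close>, so that \<open>g\<close> is positive and dominates \<open>f\<close>.\<close>

lemma hermitian_functional_eq_diff_positive:
  assumes \<psi>: "\<psi> \<in> cdual" and herm: "\<forall>x. \<psi> (adj x) = cnj (\<psi> x)"
  obtains F G where "clinear F" "clinear G" "\<forall>x. pos x \<longrightarrow> pos (F x)"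
    "\<forall>x. pos x \<longrightarrow> pos (G x)"
    "\<psi> = (\<lambda>x. F x - G x)"
proof -
  have lin: "clinear \<psi>" and bl: "bounded_linear \<psi>" using \<psi> by (auto simp: cdual_def)
  obtain K where K: "K \<ge> 0" "\<And>x. norm (\<psi> x) \<le> norm x * K"
    using bounded_linear.nonneg_bounded[OF bl] by blast
  define f where "f x = Re (\<psi> x)" for x
  have f: "f (x + y) = f x + f y" "f 0 = 0" "f (r *\<^sub>R x) = r * f x" for x y r
    by (simp_all add: f_def clinear_add[OF lin] clinear_0[OF lin] clinear_scaleR[OF lin])
  have fle: "f x \<le> K * norm x" for x
    using K(2)[of x] complex_Re_le_cmod[of "\<psi> x"] by (simp add: f_def mult.commute)
  \<comment> \<open>The constant M is 3 K, with K bounding \<psi>, to match the factor 3 in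
    \<open>norm_le_of_order_bounds\<close>: then f(b) \<le> 3 K (t + n), with n the norm of
    \<open>rpart v\<close>, bounds \<open>S v\<close> from below. Using \<open>rpart v\<close> lets
    the functional act on all vectors.\<close>
  define S where "S v = {r. \<exists>t b. pos b \<and> pos (t *\<^sub>R 1 - rpart v - b) \<and> t * (3 * K) - f b \<le> r}" for v
  have low: "- (3 * K * norm (rpart v)) \<le> r" if r: "r \<in> S v" for v r
  proof -
    obtain t b where b: "pos b" "pos (t *\<^sub>R 1 - rpart v - b)" "t * (3 * K) - f b \<le> r"
      using r by (auto simp: S_def)
    define n where "n = norm (rpart v)"
    have "pos ((t *\<^sub>R 1 - rpart v - b) + (n *\<^sub>R 1 + rpart v))"
      using b(2) pos_norm_plus[OF adj_rpart, of v] unfolding n_def by (rule pos_add)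
    then have m: "pos ((t + n) *\<^sub>R 1 - b)" by (simp add: algebra_simps)
    have "pos ((t + n) *\<^sub>R (1::'a))" using pos_add[OF m b(1)] by simp
    then have "pos ((t + n) *\<^sub>R 1 + b)" using b(1) by (rule pos_add)
    then have "norm b \<le> 3 * (t + n)" using m by (rule norm_le_of_order_bounds)
    then have "f b \<le> K * (3 * (t + n))" using fle[of b] K(1) by (meson mult_left_mono order_trans)
    then show ?thesis using b(3) by (simp add: n_def algebra_simps)
  qed
  have bdd: "bdd_below (S v)" for v using low by (force simp: bdd_below_def)
  have "sublinear (\<lambda>v. Inf (S v))"
  proof (rule sublinear_Inf)
    fix v
    have "norm (rpart v) * (3 * K) \<in> S v"
      using pos_norm_minus[OF adj_rpart, of v] unfolding S_def
      by (intro CollectI exI[of _ "norm (rpart v)"] exI[of _ 0]) (simp add: pos_0 f)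
    then show "S v \<noteq> {}" by blast
    show "bdd_below (S v)" by (rule bdd)
  next
    fix v w r s assume "r \<in> S v" "s \<in> S w"
    then obtain t b t' b' where
      b: "pos b" "pos (t *\<^sub>R 1 - rpart v - b)" "t * (3 * K) - f b \<le> r" and
      b': "pos b'" "pos (t' *\<^sub>R 1 - rpart w - b')" "t' * (3 * K) - f b' \<le> s"
      unfolding S_def by blast
    have "pos ((t + t') *\<^sub>R 1 - rpart (v + w) - (b + b'))"
      using pos_add[OF b(2) b'(2)] by (simp add: rpart_add algebra_simps)
    moreover have "(t + t') * (3 * K) - f (b + b') \<le> r + s"
      using b(3) b'(3) by (simp add: f algebra_simps)
    ultimately show "r + s \<in> S (v + w)"
      unfolding S_def using pos_add[OF b(1) b'(1)] by blast
  next
    fix v r and c :: real assume c: "c > 0" and "r \<in> S v"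
    then obtain t b where
      b: "pos b" "pos (t *\<^sub>R 1 - rpart v - b)" "t * (3 * K) - f b \<le> r" unfolding S_def by blast
    have "pos ((c * t) *\<^sub>R 1 - rpart (c *\<^sub>R v) - c *\<^sub>R b)"
      using pos_scaleR[OF b(2), of c] c by (simp add: rpart_scaleR algebra_simps)
    moreover have "(c * t) * (3 * K) - f (c *\<^sub>R b) \<le> c * r"
      using mult_left_mono[OF b(3), of c] c by (simp add: f algebra_simps)
    moreover have "pos (c *\<^sub>R b)" using pos_scaleR[OF b(1), of c] c by simp
    ultimately show "c * r \<in> S (c *\<^sub>R v)" unfolding S_def by blast
  qed
  then obtain g where g: "linear g" "\<And>v. g v \<le> Inf (S v)"
    using hahn_banach_sublinear by blast
  have gle: "g v \<le> r" if "r \<in> S v" for v r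
    using g(2)[of v] cInf_lower[OF that bdd] by linarith
  have gpos: "g b \<ge> 0" and gf: "g b \<ge> f b" if b: "pos b" for b
  proof -
    have rb: "rpart (- b) = - b" using b by (simp add: rpart_selfadj adj_simps pos_adj)
    have "0 \<in> S (- b)"
      unfolding S_def by (intro CollectI exI[of _ 0]) (simp add: rb b f pos_0)
    moreover have "- f b \<in> S (- b)"
      unfolding S_def by (intro CollectI exI[of _ 0] exI[of _ b]) (simp add: rb b f pos_0)
    ultimately show "g b \<ge> 0" "g b \<ge> f b" 
      using gle[of 0 "- b"] gle[of "- f b" "- b"] by (simp_all add: linear_neg[OF g(1)])
  qed
  show thesis
  proof (rule that[of "cext g" "\<lambda>x. cext g x - \<psi> x"])
    show "clinear (cext g)" by (rule clinear_cext[OF g(1)])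
    then show "clinear (\<lambda>x. cext g x - \<psi> x)"
      using lin by (simp add: clinear_iff scaleC_complex_def algebra_simps)
    show "\<forall>x. pos x \<longrightarrow> pos (cext g x)" using cext_pos[OF g(1) _ gpos] by blast
    show "\<forall>x. pos x \<longrightarrow> pos (cext g x - \<psi> x)"
    proof (intro allI impI)
      fix x :: 'a assume x: "pos x"
      have "cnj (\<psi> x) = \<psi> x" using spec[OF herm, of x] pos_adj[OF x] by simp
      then have "Im (\<psi> x) = 0" by (simp add: complex_eq_iff)
      then show "pos (cext g x - \<psi> x)" using gf[OF x]
        by (simp add: cext_selfadj g(1) pos_adj x pos_complex_iff complex_nonneg_Reals_iff f_def)
    qed
  qed auto
qed

lemma cdualI: "clinear f \<Longrightarrow> bounded_linear f \<Longrightarrow> f \<in> cdual"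
  and cdual_clinear: "f \<in> cdual \<Longrightarrow> clinear f"
  and cdual_bounded_linear: "f \<in> cdual \<Longrightarrow> bounded_linear f"
  by (auto simp: cdual_def)

lemma cdual_add: "f \<in> cdual \<Longrightarrow> g \<in> cdual \<Longrightarrow> (\<lambda>x. f x + g x) \<in> cdual"
  by (rule cdualI[OF clinear_complexI bounded_linear_add])
    (simp_all add: clinear_add clinear_scaleC_complex cdual_clinear cdual_bounded_linear algebra_simps)

lemma cdual_mult: "f \<in> cdual \<Longrightarrow> (\<lambda>x. c * f x) \<in> cdual"
  by (rule cdualI[OF clinear_complexI bounded_linear_const_mult])
    (simp_all add: clinear_add clinear_scaleC_complex cdual_clinear cdual_bounded_linear algebra_simps)

lemma cdual_adj:
  assumes "f \<in> cdual"
  shows "(\<lambda>x. cnj (f (adj x))) \<in> cdual"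
proof (rule cdualI[OF clinear_complexI])
  note lin = cdual_clinear[OF assms]
  show "bounded_linear (\<lambda>x. cnj (f (adj x)))"
    by (rule bounded_linear_compose[OF bounded_linear_cnj
          bounded_linear_compose[OF cdual_bounded_linear[OF assms] bounded_linear_adj]])
  show "cnj (f (adj (x + y))) = cnj (f (adj x)) + cnj (f (adj y))" for x y
    by (simp add: adj_simps clinear_add[OF lin])
  show "cnj (f (adj (c *\<^sub>C x))) = c * cnj (f (adj x))" for c x
    by (simp add: adj_simps clinear_scaleC_complex[OF lin])
qed

text \<open>A functional is \<xi> + i \<eta> with hermitian \<xi> and \<eta>, each a difference of
  positive functionals, and each positive one is zero or a multiple of a state. As an induction rule
  this reduces a property stable under sums to multiples of states.\<close>

theorem cdual_state_induct [consumes 1, case_names zero state add]: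
  fixes \<psi> :: "'a::unital_cstar_algebra \<Rightarrow> complex"
  assumes \<psi>: "\<psi> \<in> cdual" and zero: "P (\<lambda>_. 0)"
    and state: "\<And>c \<omega>. state \<omega> \<Longrightarrow> P (\<lambda>x. c * \<omega> x)"
    and add: "\<And>f g. P f \<Longrightarrow> P g \<Longrightarrow> P (\<lambda>x. f x + g x)"
  shows "P \<psi>"
proof -
  have positive: "P (\<lambda>x. c * F x)"
    if F: "clinear F" "\<forall>x. pos x \<longrightarrow> pos (F x)" for c and F :: "'a \<Rightarrow> complex"
  proof (cases rule: positive_functional_cases[OF F])
    case 1
    then show ?thesis using zero by simp
  next
    case (2 d \<omega>)
    then show ?thesis using state[OF 2(1), of "c * d"] by (simp add: mult.assoc)
  qed
  have herm: "P (\<lambda>x. c * \<xi> x)" if \<xi>: "\<xi> \<in> cdual" "\<forall>x. \<xi> (adj x) = cnj (\<xi> x)" for c \<xi>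
  proof -
    obtain F G where FG: "clinear F" "clinear G" "\<forall>x. pos x \<longrightarrow> pos (F x)"
      "\<forall>x. pos x \<longrightarrow> pos (G x)" "\<xi> = (\<lambda>x. F x - G x)"
      by (rule hermitian_functional_eq_diff_positive[OF \<xi>])
    have "P (\<lambda>x. c * F x + - c * G x)"
      by (rule add[OF positive[OF FG(1,3), of c] positive[OF FG(2,4), of "- c"]])
    then show ?thesis by (simp add: FG(5) algebra_simps)
  qed
  define \<xi> where "\<xi> x = (1 / 2) * (\<psi> x + cnj (\<psi> (adj x)))" for x
  define \<eta> where "\<eta> x = (- \<i> / 2) * (\<psi> x + - 1 * cnj (\<psi> (adj x)))" for x
  have \<xi>: "\<xi> \<in> cdual" unfolding \<xi>_def[abs_def]
    by (rule cdual_mult[OF cdual_add[OF \<psi> cdual_adj[OF \<psi>]]])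
  have \<eta>: "\<eta> \<in> cdual" unfolding \<eta>_def[abs_def]
    by (rule cdual_mult[OF cdual_add[OF \<psi> cdual_mult[OF cdual_adj[OF \<psi>]]]])
  have herm_\<xi>: "\<forall>x. \<xi> (adj x) = cnj (\<xi> x)" and herm_\<eta>: "\<forall>x. \<eta> (adj x) = cnj (\<eta> x)"
    by (simp_all add: \<xi>_def \<eta>_def adj_adj algebra_simps)
  have "P (\<lambda>x. 1 * \<xi> x + \<i> * \<eta> x)"
    by (rule add[OF herm[OF \<xi> herm_\<xi>, of 1] herm[OF \<eta> herm_\<eta>, of \<i>]])
  moreover have "(\<lambda>x. 1 * \<xi> x + \<i> * \<eta> x) = \<psi>"
  proof
    fix x
    have "\<i> * \<eta> x = (1 / 2) * (\<psi> x - cnj (\<psi> (adj x)))"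
      by (simp add: \<eta>_def complex_eq_iff field_simps)
    then show "1 * \<xi> x + \<i> * \<eta> x = \<psi> x"
      by (simp only: \<xi>_def) (simp add: algebra_simps)
  qed
  ultimately show ?thesis by simp
qed

section \<open>Product states\<close>

lemma state_clinear: "state f \<Longrightarrow> clinear f"
  and state_1: "state f \<Longrightarrow> f 1 = 1"
  and state_nonneg: "state f \<Longrightarrow> f (adj x * x) \<in> \<real>\<^sub>\<ge>\<^sub>0"
  by (auto simp: state_def)

text \<open>Degenerate Cauchy-Schwarz: positivity at y + c x with c = -t w leaves 2 t |w|^2 \<le> m
  for every real t, which is possible only for w = 0.\<close>

lemma state_null:
  assumes g: "state g" and x: "g (adj x * x) = 0"
  shows "g (adj x * y) = 0" "g (adj y * x) = 0"
proof -
  note lin = state_clinear[OF g]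
  define w where "w = g (adj x * y)"
  have yx: "g (adj y * x) = cnj w"
    using state_adj[OF g, of "adj x * y"] by (simp add: adj_simps w_def)
  define m where "m = Re (g (adj y * y))"
  have m: "m \<ge> 0" using state_nonneg[OF g, of y] by (simp add: m_def complex_nonneg_Reals_iff)
  have le: "2 * t * (cmod w)\<^sup>2 \<le> m" for t :: real
  proof -
    define c where "c = - complex_of_real t * w"
    have "g (adj (y + c *\<^sub>C x) * (y + c *\<^sub>C x)) = g (adj y * y) + c * cnj w + cnj c * w"
      by (simp add: adj_simps distrib_left distrib_right mult_scaleC_left mult_scaleC_right
          clinear_add[OF lin] clinear_scaleC_complex[OF lin] x yx w_def[symmetric])
    then have "0 \<le> Re (g (adj y * y) + c * cnj w + cnj c * w)"
      using state_nonneg[OF g, of "y + c *\<^sub>C x"] by (simp add: complex_nonneg_Reals_iff)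
    also have "\<dots> = m - 2 * t * (cmod w)\<^sup>2"
      unfolding cmod_power2 by (simp add: m_def c_def algebra_simps power2_eq_square)
    finally show ?thesis by simp
  qed
  have "w = 0"
  proof (rule ccontr)
    assume "w \<noteq> 0"
    then have p: "(cmod w)\<^sup>2 > 0" by simp
    have "2 * (m + 1) \<le> m" using le[of "(m + 1) / (cmod w)\<^sup>2"] p by simp
    then show False using m by simp
  qed
  then show "g (adj x * y) = 0" "g (adj y * x) = 0" by (simp_all add: yx w_def)
qed

lemma adj_sum: "adj (sum h I) = (\<Sum>i\<in>I. adj (h i))"
  by (rule linear_sum[OF adj_linear])

text \<open>Schur's product theorem for the Gram matrices of \<open>a\<close> and \<open>b\<close>: in the induction step one
  vector \<open>b\<^sub>k\<close> is split off from the others by orthogonal projection. If \<open>g(b\<^sub>k\<^sup>* b\<^sub>k) = 0\<close>, the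
  coefficients \<open>l i\<close> are \<open>0\<close> by the convention for division by zero.\<close>

lemma product_functional_nonneg_sum:
  assumes f: "state f" and g: "state g" and "finite I"
  shows "(\<Sum>i\<in>I. \<Sum>j\<in>I. f (adj (a i) * a j) * g (adj (b i) * b j)) \<in> \<real>\<^sub>\<ge>\<^sub>0"
  using \<open>finite I\<close>
proof (induction I arbitrary: b rule: finite_induct)
  case empty
  show ?case by simp
next
  case (insert k I)
  note flin = state_clinear[OF f] and glin = state_clinear[OF g]
  define \<gamma> where "\<gamma> = g (adj (b k) * b k)"
  define l where "l i = g (adj (b k) * b i) / \<gamma>" for i
  define b' where "b' i = b i - l i *\<^sub>C b k" for i
  define A where "A = (\<Sum>i\<in>insert k I. l i *\<^sub>C a i)"
  have \<gamma>: "\<gamma> \<in> \<real>\<^sub>\<ge>\<^sub>0" unfolding \<gamma>_def by (rule state_nonneg[OF g])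
  then have cnj\<gamma>: "cnj \<gamma> = \<gamma>" by (auto elim!: nonneg_Reals_cases)
  have lk: "g (adj (b k) * b i) = l i * \<gamma>" for i
    using state_null(1)[OF g, of "b k" "b i"] by (cases "\<gamma> = 0") (auto simp: l_def \<gamma>_def)
  have kl: "g (adj (b i) * b k) = cnj (l i) * \<gamma>" for i
    using state_adj[OF g, of "adj (b k) * b i"] by (simp add: adj_simps lk cnj\<gamma>)
  have lk1: "l k = 1" if "\<gamma> \<noteq> 0" using that by (simp add: l_def flip: \<gamma>_def)
  \<comment> \<open>Projection splits the Gram matrix of \<open>b\<close> into that of
    \<open>b'\<close> and a rank-one matrix, which contributes \<gamma> times
    \<open>f (adj A * A)\<close> to the sum.\<close>
  have bb: "g (adj (b i) * b j) = g (adj (b' i) * b' j) + cnj (l i) * l j * \<gamma>" for i j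
    unfolding b'_def
    by (cases "\<gamma> = 0") (simp_all add: lk1 adj_simps left_diff_distrib right_diff_distrib mult_scaleC_left
        mult_scaleC_right clinear_diff[OF glin] clinear_scaleC_complex[OF glin] lk kl \<gamma>_def[symmetric]
        cvec.scale_right_diff_distrib)
  \<comment> \<open>Either \<gamma> \<noteq> 0 and b' k = 0, or \<gamma> = 0 and b' k = b k is null;
    in both cases row and column k drop out, and the induction hypothesis applies to
    \<open>b'\<close> on \<open>I\<close>.\<close>
  have b'k: "g (adj (b' k) * b' j) = 0" "g (adj (b' j) * b' k) = 0" for j
  proof -
    have "g (adj (b' k) * b' k) = \<gamma> - cnj (l k) * l k * \<gamma>"
      using bb[of k k] unfolding \<gamma>_def[symmetric] eq_diff_eq by (rule sym)
    also have "\<dots> = 0" using lk1 by (cases "\<gamma> = 0") auto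
    finally have "g (adj (b' k) * b' k) = 0" .
    then show "g (adj (b' k) * b' j) = 0" "g (adj (b' j) * b' k) = 0"
      using state_null[OF g] by blast+
  qed
  let ?F = "\<lambda>b i j. f (adj (a i) * a j) * g (adj (b i) * b j)"
  have AA: "f (adj A * A) = (\<Sum>i\<in>insert k I. \<Sum>j\<in>insert k I. cnj (l i) * l j * f (adj (a i) * a j))"
    unfolding A_def
    by (simp add: adj_sum sum_product clinear_sum[OF flin] adj_simps mult_scaleC_left
        mult_scaleC_right clinear_scaleC_complex[OF flin] mult_ac del: sum.insert)
  have "(\<Sum>i\<in>insert k I. \<Sum>j\<in>insert k I. ?F b i j) =
      (\<Sum>i\<in>insert k I. \<Sum>j\<in>insert k I. ?F b' i j) + \<gamma> * f (adj A * A)"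
    unfolding AA bb sum_distrib_left sum.distrib[symmetric]
    by (intro sum.cong) (auto simp: algebra_simps)
  also have "(\<Sum>i\<in>insert k I. \<Sum>j\<in>insert k I. ?F b' i j) = (\<Sum>i\<in>I. \<Sum>j\<in>I. ?F b' i j)"
    using insert.hyps by (simp add: b'k)
  finally show ?case
    using insert.IH[of b'] \<gamma> state_nonneg[OF f, of A]
    by (simp only:) (intro nonneg_Reals_add_I nonneg_Reals_mult_I)
qed

text \<open>For states f and g this is the pre-inner product (f \<otimes> g)(x^* y) of the GNS
  construction, evaluated on representatives and conjugate-linear in the first argument.\<close>

definition alg_form ::
    "('a::unital_cstar_algebra \<Rightarrow> complex) \<Rightarrow> ('b::unital_cstar_algebra \<Rightarrow> complex) \<Rightarrow>
     ('a \<times> 'b) list \<Rightarrow> ('a \<times> 'b) list \<Rightarrow> complex"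
  where "alg_form f g xs ys =
    (\<Sum>p\<leftarrow>xs. \<Sum>q\<leftarrow>ys. f (adj (fst p) * fst q) * g (adj (snd p) * snd q))"

lemma alg_form_nonneg:
  assumes "state f" "state g"
  shows "alg_form f g xs xs \<in> \<real>\<^sub>\<ge>\<^sub>0"
proof -
  have "alg_form f g xs xs = (\<Sum>i\<in>{0..<length xs}. \<Sum>j\<in>{0..<length xs}.
      f (adj (fst (xs ! i)) * fst (xs ! j)) * g (adj (snd (xs ! i)) * snd (xs ! j)))"
    by (simp add: alg_form_def sum_list_sum_nth)
  then show ?thesis
    using product_functional_nonneg_sum[OF assms, of "{0..<length xs}" "\<lambda>i. fst (xs ! i)"
        "\<lambda>i. snd (xs ! i)"] by simp
qed

lemma alg_functional_Nil: "alg_functional f g [] = 0"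
  and alg_functional_append:
    "alg_functional f g (xs @ ys) = alg_functional f g xs + alg_functional f g ys"
  by (simp_all add: alg_functional_def)

lemma alg_mult_Nil: "alg_mult [] ys = []"
  and alg_mult_Cons:
    "alg_mult (p # xs) ys = map (\<lambda>q. (fst p * fst q, snd p * snd q)) ys @ alg_mult xs ys"
  by (simp_all add: alg_mult_def case_prod_beta)

lemma alg_adj_Nil: "alg_adj [] = []"
  and alg_adj_Cons: "alg_adj (p # xs) = (adj (fst p), adj (snd p)) # alg_adj xs"
  by (simp_all add: alg_adj_def case_prod_beta)

lemma alg_functional_adj_mult:
  "alg_functional f g (alg_mult (alg_adj xs) ys) = alg_form f g xs ys"
  by (induction xs)
    (simp_all add: alg_mult_Nil alg_mult_Cons alg_adj_Nil alg_adj_Cons alg_form_def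
      alg_functional_append alg_functional_Nil, simp add: alg_functional_def comp_def)

definition alg_scale :: "complex \<Rightarrow> ('a::unital_cstar_algebra \<times> 'b) list \<Rightarrow> ('a \<times> 'b) list"
  where "alg_scale c xs = map (\<lambda>p. (c *\<^sub>C fst p, snd p)) xs"

lemma alg_functional_scale:
  "clinear f \<Longrightarrow> alg_functional f g (alg_scale c xs) = c * alg_functional f g xs"
  by (induction xs) (auto simp: alg_functional_def alg_scale_def clinear_scaleC_complex algebra_simps)

lemma alg_form_append:
  "alg_form f g (xs @ ys) zs = alg_form f g xs zs + alg_form f g ys zs"
  "alg_form f g zs (xs @ ys) = alg_form f g zs xs + alg_form f g zs ys"
  by (simp_all add: alg_form_def sum_list_addf)

lemma alg_form_scale:
  assumes "clinear f"
  shows "alg_form f g (alg_scale c xs) zs = cnj c * alg_form f g xs zs"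
    "alg_form f g zs (alg_scale c xs) = c * alg_form f g zs xs"
  using assms
  by (simp_all add: alg_form_def alg_scale_def comp_def adj_scaleC mult_scaleC_left
      mult_scaleC_right clinear_scaleC_complex sum_list_const_mult mult.assoc)

text \<open>Half of the parallelogram law: the form at the difference of \<open>xs\<close> and
  \<open>ys\<close> is nonnegative.\<close>

lemma alg_form_add_le:
  assumes f: "state f" and g: "state g"
  shows "Re (alg_form f g (xs @ ys) (xs @ ys)) \<le>
    2 * Re (alg_form f g xs xs) + 2 * Re (alg_form f g ys ys)"
proof -
  have "alg_form f g (xs @ alg_scale (- 1) ys) (xs @ alg_scale (- 1) ys) \<in> \<real>\<^sub>\<ge>\<^sub>0"
    by (rule alg_form_nonneg[OF f g])
  then show ?thesis
    by (simp add: alg_form_append alg_form_scale state_clinear[OF f] complex_nonneg_Reals_iff)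
qed

text \<open>This turns the numerator in \<open>min_tensor_norm\<close> into the form at
  \<open>alg_mult x y\<close>.\<close>

lemma alg_form_mult_left_adj:
  "alg_form f g ys (alg_mult (alg_adj xs) zs) = alg_form f g (alg_mult xs ys) zs"
proof (induction xs)
  case Nil
  then show ?case by (simp add: alg_mult_Nil alg_adj_Nil alg_form_def)
next
  case (Cons p xs)
  have "alg_form f g ys (map (\<lambda>q. (adj (fst p) * fst q, adj (snd p) * snd q)) zs) =
      alg_form f g (map (\<lambda>q. (fst p * fst q, snd p * snd q)) ys) zs"
    by (simp add: alg_form_def comp_def adj_mult mult.assoc)
  then show ?case using Cons by (simp add: alg_mult_Cons alg_adj_Cons alg_form_append)
qed

lemma norm_minus_square_eq_square:
  obtains h where "adj h * h = (norm a)\<^sup>2 *\<^sub>R 1 - adj a * a"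
proof -
  have "pos ((norm a)\<^sup>2 *\<^sub>R 1 - adj a * a)"
    using pos_norm_minus[of "adj a * a"] by (simp add: adj_simps norm_adj_mult_self)
  then show thesis using that by (auto simp: pos_iff)
qed

text \<open>With h^* h = \<parallel>a\<parallel>^2 1 - a^* a, the form at h y is
  \<parallel>a\<parallel>^2 times the form at y minus the form at a y; its nonnegativity is the
  claim. The two tensor factors are treated one after the other.\<close>

lemma alg_form_mult_elementary_le:
  assumes f: "state f" and g: "state g"
  shows "Re (alg_form f g (map (\<lambda>q. (a * fst q, b * snd q)) ys) (map (\<lambda>q. (a * fst q, b * snd q)) ys))
    \<le> (norm a)\<^sup>2 * (norm b)\<^sup>2 * Re (alg_form f g ys ys)"
proof -
  note flin = state_clinear[OF f] and glin = state_clinear[OF g]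
  have L: "Re (alg_form f g (map (\<lambda>q. (a * fst q, snd q)) zs) (map (\<lambda>q. (a * fst q, snd q)) zs))
      \<le> (norm a)\<^sup>2 * Re (alg_form f g zs zs)" for zs
  proof -
    obtain h where h: "adj h * h = (norm a)\<^sup>2 *\<^sub>R 1 - adj a * a" by (rule norm_minus_square_eq_square)
    have "f (adj (h * x) * (h * y)) = (norm a)\<^sup>2 * f (adj x * y) - f (adj (a * x) * (a * y))" for x y
    proof -
      have "adj (h * x) * (h * y) = adj x * (adj h * h) * y" by (simp add: adj_mult mult.assoc)
      also have "\<dots> = (norm a)\<^sup>2 *\<^sub>R (adj x * y) - adj (a * x) * (a * y)"
        unfolding h by (simp add: adj_mult algebra_simps)
      finally show ?thesis
        by (simp add: clinear_diff[OF flin] clinear_scaleR[OF flin]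
            scaleR_conv_of_real[where 'a = complex])
    qed
    then have "alg_form f g (map (\<lambda>q. (h * fst q, snd q)) zs) (map (\<lambda>q. (h * fst q, snd q)) zs) =
        (norm a)\<^sup>2 * alg_form f g zs zs
        - alg_form f g (map (\<lambda>q. (a * fst q, snd q)) zs) (map (\<lambda>q. (a * fst q, snd q)) zs)"
      by (simp add: alg_form_def comp_def left_diff_distrib sum_list_subtractf sum_list_const_mult
          mult.assoc)
    then show ?thesis
      using alg_form_nonneg[OF f g, of "map (\<lambda>q. (h * fst q, snd q)) zs"]
      by (simp add: complex_nonneg_Reals_iff)
  qed
  have R: "Re (alg_form f g (map (\<lambda>q. (fst q, b * snd q)) zs) (map (\<lambda>q. (fst q, b * snd q)) zs))
      \<le> (norm b)\<^sup>2 * Re (alg_form f g zs zs)" for zs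
  proof -
    obtain h where h: "adj h * h = (norm b)\<^sup>2 *\<^sub>R 1 - adj b * b" by (rule norm_minus_square_eq_square)
    have gh: "g (adj (h * x) * (h * y)) = (norm b)\<^sup>2 * g (adj x * y) - g (adj (b * x) * (b * y))" for x y
    proof -
      have "adj (h * x) * (h * y) = adj x * (adj h * h) * y" by (simp add: adj_mult mult.assoc)
      also have "\<dots> = (norm b)\<^sup>2 *\<^sub>R (adj x * y) - adj (b * x) * (b * y)"
        unfolding h by (simp add: adj_mult algebra_simps)
      finally show ?thesis
        by (simp add: clinear_diff[OF glin] clinear_scaleR[OF glin]
            scaleR_conv_of_real[where 'a = complex])
    qed
    have "u * g (adj (h * x) * (h * y)) =
        (norm b)\<^sup>2 * (u * g (adj x * y)) - u * g (adj (b * x) * (b * y))" for u x y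
      by (simp only: gh) (simp add: algebra_simps)
    then have "alg_form f g (map (\<lambda>q. (fst q, h * snd q)) zs) (map (\<lambda>q. (fst q, h * snd q)) zs) =
        (norm b)\<^sup>2 * alg_form f g zs zs
        - alg_form f g (map (\<lambda>q. (fst q, b * snd q)) zs) (map (\<lambda>q. (fst q, b * snd q)) zs)"
      by (simp add: alg_form_def comp_def sum_list_subtractf sum_list_const_mult)
    then show ?thesis
      using alg_form_nonneg[OF f g, of "map (\<lambda>q. (fst q, h * snd q)) zs"]
      by (simp add: complex_nonneg_Reals_iff)
  qed
  have "Re (alg_form f g (map (\<lambda>q. (a * fst q, b * snd q)) ys) (map (\<lambda>q. (a * fst q, b * snd q)) ys))
      \<le> (norm a)\<^sup>2 * Re (alg_form f g (map (\<lambda>q. (fst q, b * snd q)) ys) (map (\<lambda>q. (fst q, b * snd q)) ys))"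
    using L[of "map (\<lambda>q. (fst q, b * snd q)) ys"] by (simp add: comp_def)
  also have "\<dots> \<le> (norm a)\<^sup>2 * ((norm b)\<^sup>2 * Re (alg_form f g ys ys))"
    by (intro mult_left_mono R) simp
  finally show ?thesis by (simp add: mult.assoc)
qed

text \<open>The constant depends on \<open>xs\<close> alone, which is what bounds the set under the
  supremum in \<open>min_tensor_norm\<close>; its growth with the length of the list is
  harmless.\<close>

lemma alg_form_mult_bounded:
  "\<exists>K. \<forall>f g ys. state f \<longrightarrow> state g \<longrightarrow>
    Re (alg_form f g (alg_mult xs ys) (alg_mult xs ys)) \<le> K * Re (alg_form f g ys ys)"
proof (induction xs)
  case Nil
  show ?case by (rule exI[of _ 0]) (simp add: alg_mult_Nil alg_form_def)
next
  case (Cons p xs)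
  then obtain K where K: "\<And>f g ys. state f \<Longrightarrow> state g \<Longrightarrow>
      Re (alg_form f g (alg_mult xs ys) (alg_mult xs ys)) \<le> K * Re (alg_form f g ys ys)"
    by blast
  define c where "c = (norm (fst p))\<^sup>2 * (norm (snd p))\<^sup>2"
  have "Re (alg_form f g (alg_mult (p # xs) ys) (alg_mult (p # xs) ys))
      \<le> (2 * c + 2 * K) * Re (alg_form f g ys ys)" if f: "state f" and g: "state g" for f g ys
  proof -
    let ?u = "map (\<lambda>q. (fst p * fst q, snd p * snd q)) ys"
    have "Re (alg_form f g (alg_mult (p # xs) ys) (alg_mult (p # xs) ys))
        \<le> 2 * Re (alg_form f g ?u ?u) + 2 * Re (alg_form f g (alg_mult xs ys) (alg_mult xs ys))"
      unfolding alg_mult_Cons by (rule alg_form_add_le[OF f g])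
    also have "\<dots> \<le> 2 * (c * Re (alg_form f g ys ys)) + 2 * (K * Re (alg_form f g ys ys))"
      using alg_form_mult_elementary_le[OF f g, of "fst p" "snd p" ys] K[OF f g, of ys]
      by (simp add: c_def)
    finally show ?thesis by (simp add: algebra_simps)
  qed
  then show ?case by blast
qed

text \<open>Taking 1 \<otimes> 1 for y in the supremum gives (f \<otimes> g)(x^* x) \<le>
  \<parallel>x\<parallel>^2, and Cauchy-Schwarz against 1 \<otimes> 1 does the rest. The set must
  first be shown bounded, as \<open>Sup\<close> is known to be an upper bound only then.\<close>

lemma alg_functional_le_min_tensor_norm:
  assumes f: "state f" and g: "state g"
  shows "cmod (alg_functional f g xs) \<le> min_tensor_norm xs"
proof -
  define N where "N = {Re (alg_functional f g (alg_mult (alg_adj y) (alg_mult (alg_adj xs) (alg_mult xs y))))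
       / Re (alg_functional f g (alg_mult (alg_adj y) y)) | f g y.
      state f \<and> state g \<and> alg_functional f g (alg_mult (alg_adj y) y) \<noteq> 0}"
  note flin = state_clinear[OF f]
  obtain K where K: "\<And>f g ys. state f \<Longrightarrow> state g \<Longrightarrow>
      Re (alg_form f g (alg_mult xs ys) (alg_mult xs ys)) \<le> K * Re (alg_form f g ys ys)"
    using alg_form_mult_bounded[of xs] by blast
  have "bdd_above N"
  proof (rule bdd_aboveI)
    fix r assume "r \<in> N"
    then obtain f g y where fg: "state f" "state g" and nz: "alg_form f g y y \<noteq> 0"
      and r: "r = Re (alg_form f g (alg_mult xs y) (alg_mult xs y)) / Re (alg_form f g y y)"
      by (auto simp: N_def alg_functional_adj_mult alg_form_mult_left_adj)
    have "Re (alg_form f g y y) > 0"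
      using alg_form_nonneg[OF fg, of y] nz by (auto simp: complex_nonneg_Reals_iff complex_eq_iff)
    then show "r \<le> K" using K[OF fg, of y] by (simp add: r field_simps)
  qed
  moreover have "Re (alg_form f g xs xs) \<in> N"
  proof -
    have one: "alg_form f g [(1, 1)] [(1, 1)] = 1"
      by (simp add: alg_form_def adj_1 state_1 f g)
    have "alg_mult xs [(1, 1)] = xs"
      by (induction xs) (simp_all add: alg_mult_Nil alg_mult_Cons)
    then show ?thesis
      unfolding N_def using f g one
      by (auto simp: alg_functional_adj_mult alg_form_mult_left_adj
          intro!: exI[of _ f] exI[of _ g] exI[of _ "[(1, 1)]"])
  qed
  ultimately have le: "Re (alg_form f g xs xs) \<le> Sup N" by (intro cSup_upper)
  define w where "w = alg_functional f g xs"
  have w: "alg_form f g [(1, 1)] xs = w"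
    unfolding w_def by (simp add: alg_form_def alg_functional_def adj_1 case_prod_unfold)
  have w': "alg_form f g xs [(1, 1)] = cnj w"
  proof -
    have "alg_form f g xs [(1, 1)] = (\<Sum>p\<leftarrow>xs. cnj (f (fst p) * g (snd p)))"
      by (simp add: alg_form_def state_adj f g)
    also have "\<dots> = cnj w" unfolding w_def by (induction xs) (auto simp: alg_functional_def)
    finally show ?thesis .
  qed
  \<comment> \<open>Cauchy-Schwarz as a variance: the form at x - w (1 \<otimes> 1) is (f \<otimes>
    g)(x^* x) - |w|^2.\<close>
  have "alg_form f g (xs @ alg_scale (- w) [(1, 1)]) (xs @ alg_scale (- w) [(1, 1)]) \<in> \<real>\<^sub>\<ge>\<^sub>0"
    by (rule alg_form_nonneg[OF f g])
  moreover have "alg_form f g [(1, 1)] [(1, 1)] = 1" by (simp add: alg_form_def adj_1 state_1 f g)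
  ultimately have "0 \<le> Re (alg_form f g xs xs) - (cmod w)\<^sup>2"
    unfolding cmod_power2
    by (simp add: alg_form_append alg_form_scale flin w w' complex_nonneg_Reals_iff
        power2_eq_square)
  then have "(cmod w)\<^sup>2 \<le> Sup N" using le by simp
  then show ?thesis
    unfolding min_tensor_norm_def N_def[symmetric] w_def[symmetric] by (rule real_le_rsqrt)
qed

section \<open>The completed tensor product\<close>

definition tens_eval ::
    "('a::unital_cstar_algebra \<Rightarrow> 'b::unital_cstar_algebra \<Rightarrow> 'c::unital_cstar_algebra) \<Rightarrow>
     ('a \<times> 'b) list \<Rightarrow> 'c"
  where "tens_eval tens xs = (\<Sum>(a, b)\<leftarrow>xs. tens a b)"

lemma tens_eval_Nil: "tens_eval tens [] = 0"
  and tens_eval_append: "tens_eval tens (xs @ ys) = tens_eval tens xs + tens_eval tens ys"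
  by (simp_all add: tens_eval_def)

context
  fixes tens :: "'a::unital_cstar_algebra \<Rightarrow> 'b::unital_cstar_algebra \<Rightarrow> 'c::unital_cstar_algebra"
  assumes tens: "is_min_tensor_product tens"
begin

lemma tens_clinear_left: "clinear (\<lambda>a. tens a b)"
  and tens_adj: "adj (tens a b) = tens (adj a) (adj b)"
  and tens_1: "tens 1 1 = 1"
  and tens_norm: "norm (tens_eval tens xs) = min_tensor_norm xs"
  and tens_dense: "closure (cvec.span {tens a b | a b. True}) = UNIV"
  using tens unfolding is_min_tensor_product_def tens_eval_def by auto

lemma tens_eval_scale: "tens_eval tens (alg_scale c xs) = c *\<^sub>C tens_eval tens xs"
  by (induction xs) (auto simp: tens_eval_def alg_scale_def clinear_scaleC[OF tens_clinear_left]
      scaleC_add_right)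

lemma tensor_induct:
  assumes "closed S" "cvec.subspace S" "\<And>a b. tens a b \<in> S"
  shows "z \<in> S"
proof -
  have "cvec.span {tens a b | a b. True} \<subseteq> S"
    using assms(3) by (intro cvec.span_minimal assms(2)) auto
  then have "closure (cvec.span {tens a b | a b. True}) \<subseteq> S"
    by (rule closure_minimal[OF _ assms(1)])
  then have "UNIV \<subseteq> S" unfolding tens_dense .
  then show ?thesis by blast
qed

text \<open>Hahn-Banach for the functional \<open>f \<otimes> g\<close> on the algebraic tensor product, whose
  contractivity also makes it well defined.\<close>

lemma product_state_exists:
  assumes f: "state f" and g: "state g"
  obtains \<Omega> where "state \<Omega>" "\<And>a b. \<Omega> (tens a b) = f a * g b"
proof -
  define F where "F xs = Re (alg_functional f g xs)" for xs
  let ?e = "tens_eval tens"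
  note flin = state_clinear[OF f] and glin = state_clinear[OF g]
  have Fle: "\<bar>F xs\<bar> \<le> norm (?e xs)" for xs
    using alg_functional_le_min_tensor_norm[OF f g, of xs] abs_Re_le_cmod[of "alg_functional f g xs"]
    by (simp add: F_def tens_norm)
  \<comment> \<open>The infimal convolution of F and the norm: the list [] bounds \<open>h\<close>
    by the norm, and the list \<open>xs\<close> bounds \<open>h\<close> at \<open>?e xs\<close> by
    \<open>F xs\<close>.\<close>
  define S where "S z = {r. \<exists>xs. F xs + norm (z - ?e xs) \<le> r}" for z
  have low: "- norm z \<le> r" if "r \<in> S z" for r z
  proof -
    obtain xs where r: "F xs + norm (z - ?e xs) \<le> r" using \<open>r \<in> S z\<close> by (auto simp: S_def)
    have "norm (?e xs) \<le> norm z + norm (z - ?e xs)"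
      using norm_triangle_ineq4[of z "z - ?e xs"] by simp
    then show ?thesis using r Fle[of xs] by linarith
  qed
  have bdd: "bdd_below (S z)" for z using low by (force simp: bdd_below_def)
  have "sublinear (\<lambda>z. Inf (S z))"
  proof (rule sublinear_Inf)
    show "S v \<noteq> {}" for v unfolding S_def by blast
    show "bdd_below (S v)" for v by (rule bdd)
  next
    fix v w r s assume "r \<in> S v" "s \<in> S w"
    then obtain xs ys where xs: "F xs + norm (v - ?e xs) \<le> r" and ys: "F ys + norm (w - ?e ys) \<le> s"
      by (auto simp: S_def)
    have "norm (v + w - ?e (xs @ ys)) \<le> norm (v - ?e xs) + norm (w - ?e ys)"
      using norm_triangle_ineq[of "v - ?e xs" "w - ?e ys"]
      by (simp add: tens_eval_append algebra_simps)
    then have "F (xs @ ys) + norm (v + w - ?e (xs @ ys)) \<le> r + s"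
      using xs ys by (simp add: F_def alg_functional_append)
    then show "r + s \<in> S (v + w)" unfolding S_def by blast
  next
    fix v r and c :: real assume c: "c > 0" and "r \<in> S v"
    then obtain xs where xs: "F xs + norm (v - ?e xs) \<le> r" by (auto simp: S_def)
    have "c *\<^sub>R v - ?e (alg_scale c xs) = c *\<^sub>R (v - ?e xs)"
      by (simp add: tens_eval_scale scaleC_of_real algebra_simps)
    then have "norm (c *\<^sub>R v - ?e (alg_scale c xs)) = c * norm (v - ?e xs)" using c by simp
    moreover have "F (alg_scale c xs) = c * F xs" by (simp add: F_def alg_functional_scale flin)
    ultimately have "F (alg_scale c xs) + norm (c *\<^sub>R v - ?e (alg_scale c xs)) \<le> c * r"
      using mult_left_mono[OF xs, of c] c by (simp add: algebra_simps)
    then show "c * r \<in> S (c *\<^sub>R v)" unfolding S_def by blast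
  qed
  then obtain h where h: "linear h" "\<And>z. h z \<le> Inf (S z)"
    using hahn_banach_sublinear by blast
  have hle: "h z \<le> r" if "r \<in> S z" for z r
    using h(2)[of z] cInf_lower[OF that bdd] by linarith
  have h_norm: "h z \<le> norm z" for z
    by (rule hle) (auto simp: S_def F_def alg_functional_Nil tens_eval_Nil intro!: exI[of _ "[]"])
  have h_le: "h (?e xs) \<le> F xs" for xs
    by (rule hle) (auto simp: S_def intro!: exI[of _ xs])
  have h_eval: "h (?e xs) = F xs" for xs
  proof (rule antisym[OF h_le])
    have "?e (alg_scale (- 1) xs) = - ?e xs" "F (alg_scale (- 1) xs) = - F xs"
      by (simp_all add: tens_eval_scale F_def alg_functional_scale flin)
    then show "F xs \<le> h (?e xs)" using h_le[of "alg_scale (- 1) xs"] by (simp add: linear_neg[OF h(1)])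
  qed
  have h1: "h 1 = 1"
    using h_eval[of "[(1, 1)]"]
    by (simp add: tens_eval_def tens_1 F_def alg_functional_def state_1 f g)
  \<comment> \<open>A functional dominated by the norm with value 1 at 1 is positive: s - h(y) = h(s
    1 - y) \<le> s.\<close>
  have h_pos: "h y \<ge> 0" if y: "pos y" for y
  proof -
    obtain s where "norm (s *\<^sub>R 1 - y) \<le> s" using y by (auto simp: pos_def)
    then have "s - h y \<le> s"
      using h_norm[of "s *\<^sub>R 1 - y"] by (simp add: linear_diff[OF h(1)] linear_scale[OF h(1)] h1)
    then show ?thesis by simp
  qed
  have "cext h (tens a b) = f a * g b" for a b
  proof -
    have "rpart (tens a b) = ?e [((1 / 2) *\<^sub>C a, b), ((1 / 2) *\<^sub>C adj a, adj b)]"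
      by (simp add: rpart_def tens_eval_def tens_adj clinear_scaleC[OF tens_clinear_left]
          scaleR_scaleC scaleC_add_right)
    moreover have "ipart (tens a b) = ?e [((- \<i> / 2) *\<^sub>C a, b), ((\<i> / 2) *\<^sub>C adj a, adj b)]"
      by (simp add: ipart_def tens_eval_def tens_adj clinear_scaleC[OF tens_clinear_left]
          clinear_minus[OF tens_clinear_left] scaleC_minus_ii cvec.scale_right_diff_distrib)
    ultimately show ?thesis
      by (simp add: cext_def h_eval F_def alg_functional_def clinear_scaleC_complex[OF flin]
          clinear_minus[OF flin] state_adj f g complex_eq_iff) (simp add: field_simps)
  qed
  moreover have "state (cext h)" by (rule state_cext[OF h(1) h_pos h1])
  ultimately show thesis by (rule that[rotated])
qed

end

section \<open>Cesaro averages and unique ergodicity\<close>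

definition cesaro_null :: "(nat \<Rightarrow> complex) \<Rightarrow> bool"
  where "cesaro_null a \<longleftrightarrow> (\<lambda>n. (1 / real n) * (\<Sum>k<n. cmod (a k))) \<longlonglongrightarrow> 0"

lemma strictly_weak_mixing_iff:
  "strictly_weak_mixing \<phi> T \<longleftrightarrow>
    (\<forall>x. \<forall>\<psi>\<in>cdual. cesaro_null (\<lambda>k. \<psi> ((T ^^ k) x) - \<psi> 1 * \<phi> x))"
  by (simp add: strictly_weak_mixing_def cesaro_null_def)

lemma cesaro_null_dominated:
  assumes a: "cesaro_null a" and b: "cesaro_null b"
    and le: "\<And>k. cmod (c k) \<le> A * cmod (a k) + B * cmod (b k)"
  shows "cesaro_null c"
proof -
  let ?m = "\<lambda>a n. (1 / real n) * (\<Sum>k<n. cmod (a k))"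
  have "(\<lambda>n. A * ?m a n + B * ?m b n) \<longlonglongrightarrow> A * 0 + B * 0"
    using a b unfolding cesaro_null_def by (intro tendsto_intros)
  moreover have "?m c n \<le> A * ?m a n + B * ?m b n" for n
  proof -
    have "?m c n \<le> (1 / real n) * (\<Sum>k<n. A * cmod (a k) + B * cmod (b k))"
      by (intro mult_left_mono sum_mono le) auto
    also have "\<dots> = A * ?m a n + B * ?m b n"
      by (simp add: sum.distrib algebra_simps add_divide_distrib flip: sum_distrib_left)
    finally show ?thesis .
  qed
  ultimately show ?thesis
    unfolding cesaro_null_def
    by (intro tendsto_sandwich[of "\<lambda>_. 0" "?m c" sequentially "\<lambda>n. A * ?m a n + B * ?m b n"])
      (auto simp: sum_nonneg)
qed

lemma cesaro_null_add: "cesaro_null a \<Longrightarrow> cesaro_null b \<Longrightarrow> cesaro_null (\<lambda>k. a k + b k)"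
  by (rule cesaro_null_dominated[of a b _ 1 1]) (auto intro: norm_triangle_ineq)

lemma cesaro_null_mult: "cesaro_null a \<Longrightarrow> cesaro_null (\<lambda>k. c * a k)"
  by (rule cesaro_null_dominated[of a a _ "cmod c" 0]) (auto simp: norm_mult)

lemma cesaro_null_0: "cesaro_null (\<lambda>_. 0)"
  by (simp add: cesaro_null_def)

lemma cesaro_null_sum:
  "(\<And>i. i \<in> I \<Longrightarrow> cesaro_null (a i)) \<Longrightarrow> cesaro_null (\<lambda>k. \<Sum>i\<in>I. a i k)"
  by (induction I rule: infinite_finite_induct) (auto simp: cesaro_null_0 cesaro_null_add)

text \<open>An error that is uniform in k survives averaging. This serves both limits of vectors and
  limits of functionals.\<close>

lemma cesaro_null_approx:
  assumes "\<And>e. e > 0 \<Longrightarrow> \<exists>a. cesaro_null a \<and> (\<forall>k. cmod (c k) \<le> cmod (a k) + e)"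
  shows "cesaro_null c"
  unfolding cesaro_null_def
proof (rule LIMSEQ_I)
  fix e :: real assume e: "e > 0"
  let ?m = "\<lambda>a n. (1 / real n) * (\<Sum>k<n. cmod (a k))"
  obtain a where a: "cesaro_null a" "\<And>k. cmod (c k) \<le> cmod (a k) + e / 2"
    using assms[of "e / 2"] e by auto
  obtain N where N: "\<And>n. n \<ge> N \<Longrightarrow> norm (?m a n - 0) < e / 2"
    using LIMSEQ_D[OF a(1)[unfolded cesaro_null_def], of "e / 2"] e by auto
  have "norm (?m c n - 0) < e" if n: "n \<ge> N" for n
  proof -
    have "?m c n \<le> (1 / real n) * (\<Sum>k<n. cmod (a k) + e / 2)"
      by (intro mult_left_mono sum_mono a) auto
    also have "\<dots> \<le> ?m a n + e / 2" using e by (cases "n = 0") (simp_all add: sum.distrib distrib_left)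
    also have "\<dots> < e" using N[OF n] unfolding real_norm_def by linarith
    finally show ?thesis by (simp add: sum_nonneg)
  qed
  then show "\<exists>N. \<forall>n\<ge>N. norm (?m c n - 0) < e" by blast
qed

text \<open>Cauchy-Schwarz: the square of a mean is at most the mean of the squares.\<close>

lemma cesaro_null_square:
  assumes "(\<lambda>n. (1 / real n) * (\<Sum>k<n. (cmod (a k))\<^sup>2)) \<longlonglongrightarrow> 0"
  shows "cesaro_null a"
proof -
  let ?m = "\<lambda>n. (1 / real n) * (\<Sum>k<n. cmod (a k))"
    and ?q = "\<lambda>n. (1 / real n) * (\<Sum>k<n. (cmod (a k))\<^sup>2)"
  have "?m n \<le> sqrt (?q n)" for n
  proof (rule real_le_rsqrt)
    have "(\<Sum>k<n. cmod (a k))\<^sup>2 \<le> (\<Sum>k<n. (cmod (a k))\<^sup>2) * real n"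
      using sum_squared_le_sum_of_squares[of "\<lambda>k. cmod (a k)" "{..<n}"] by simp
    then show "(?m n)\<^sup>2 \<le> ?q n"
      by (cases "n = 0") (simp_all add: power2_eq_square field_simps)
  qed
  moreover have "(\<lambda>n. sqrt (?q n)) \<longlonglongrightarrow> 0" using tendsto_real_sqrt[OF assms] by simp
  ultimately show ?thesis
    unfolding cesaro_null_def
    by (intro tendsto_sandwich[of "\<lambda>_. 0" ?m sequentially "\<lambda>n. sqrt (?q n)"]) (auto simp: sum_nonneg)
qed

section \<open>Ergodic averages of states\<close>

lemma state_norm_le: "state f \<Longrightarrow> cmod (f x) \<le> 6 * norm x"
  using pos_unital_norm_le[of f x] by (simp add: state_iff_pos_unital)

lemma state_compose_funpow:
  fixes S :: "'a::unital_cstar_algebra \<Rightarrow> 'a"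
  assumes "state \<Omega>" "pos_unital S"
  shows "state (\<lambda>x. \<Omega> ((S ^^ k) x))"
  using pos_unital_compose[OF pos_unital_funpow[OF assms(2), of k], of \<Omega>] assms(1)
  by (simp add: state_iff_pos_unital comp_def)

lemma linear_invariant_cext:
  assumes g: "linear g" and S: "pos_unital S" and inv: "\<And>x. g (S x) = g x"
  shows "cext g \<circ> S = cext g"
proof
  fix x
  note lin = pos_unital_clinear[OF S]
  have "rpart (S x) = S (rpart x)" "ipart (S x) = S (ipart x)"
    by (simp_all add: rpart_def ipart_def clinear_add[OF lin] clinear_diff[OF lin]
        clinear_minus[OF lin] clinear_scaleR[OF lin] clinear_scaleC[OF lin] pos_unital_adj[OF S])
  then show "(cext g \<circ> S) x = cext g x" by (simp add: cext_def inv)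
qed

text \<open>Hahn-Banach for \<open>q(v) = limsup Re (w\<^sub>n(v))\<close>, where \<open>w\<^sub>n\<close> are the ergodic averages of \<open>\<Omega>\<close>:
  every linear functional below \<open>q\<close> yields an invariant state, and one of them takes the value
  \<open>q(z)\<close> at \<open>z\<close>.\<close>

lemma uniquely_ergodic_limsup_average:
  fixes S :: "'a::unital_cstar_algebra \<Rightarrow> 'a"
  assumes S: "pos_unital S" and \<Omega>: "state \<Omega>"
    and uniq: "\<And>\<omega>. state \<omega> \<Longrightarrow> \<omega> \<circ> S = \<omega> \<Longrightarrow> \<omega> = \<Phi>"
    and z: "adj z = z" and e: "e > 0"
  shows "eventually (\<lambda>n. (1 / real n) * (\<Sum>k<n. Re (\<Omega> ((S ^^ k) z))) < Re (\<Phi> z) + e) sequentially"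
proof -
  define w where "w n v = (1 / real n) * (\<Sum>k<n. Re (\<Omega> ((S ^^ k) v)))" for n v
  note st = state_compose_funpow[OF \<Omega> S]
  note lin = state_clinear[OF st]
  have w_add: "w n (u + v) = w n u + w n v" and w_scale: "w n (c *\<^sub>R u) = c * w n u"
    and w_minus: "w n (- u) = - w n u" for n u v c
    by (simp_all add: w_def clinear_add[OF lin] clinear_scaleR[OF lin] clinear_minus[OF lin]
        sum.distrib sum_negf algebra_simps add_divide_distrib flip: sum_distrib_left)
  have w_le: "w n v \<le> 6 * norm v" for n v
  proof -
    have "w n v \<le> (1 / real n) * (\<Sum>k<n. 6 * norm v)"
      unfolding w_def
      by (intro mult_left_mono sum_mono order_trans[OF complex_Re_le_cmod state_norm_le[OF st]]) auto
    also have "\<dots> \<le> 6 * norm v" by (cases "n = 0") auto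
    finally show ?thesis .
  qed
  \<comment> \<open>\<open>R v\<close> collects the eventual upper bounds of \<open>w n v\<close>,
    so its infimum is the limsup as a real number.\<close>
  define R where "R v = {r. eventually (\<lambda>n. w n v \<le> r) sequentially}" for v
  have low: "- (6 * norm v) \<le> r" if "r \<in> R v" for r v
  proof -
    obtain n where "w n v \<le> r"
      using \<open>r \<in> R v\<close> eventually_happens'[of sequentially] by (force simp: R_def)
    then show ?thesis using w_le[of n "- v"] by (simp add: w_minus)
  qed
  have bdd: "bdd_below (R v)" for v using low by (force simp: bdd_below_def)
  have ne: "R v \<noteq> {}" for v using w_le by (auto simp: R_def intro!: exI[of _ "6 * norm v"])
  have "sublinear (\<lambda>v. Inf (R v))"
  proof (rule sublinear_Inf)
    show "R v \<noteq> {}" "bdd_below (R v)" for v by (rule ne bdd)+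
  next
    fix u v r s assume "r \<in> R u" "s \<in> R v"
    then have "eventually (\<lambda>n. w n u \<le> r) sequentially" "eventually (\<lambda>n. w n v \<le> s) sequentially"
      by (auto simp: R_def)
    then have "eventually (\<lambda>n. w n (u + v) \<le> r + s) sequentially"
      by eventually_elim (simp add: w_add)
    then show "r + s \<in> R (u + v)" by (simp add: R_def)
  next
    fix v r and c :: real assume "c > 0" "r \<in> R v"
    then show "c * r \<in> R (c *\<^sub>R v)" by (simp add: R_def w_scale)
  qed
  then obtain g where g: "linear g" "\<And>v. g v \<le> Inf (R v)" "g z = Inf (R z)"
    using hahn_banach_sublinear[of _ z] by blast
  have gle: "g v \<le> r" if "eventually (\<lambda>n. w n v \<le> r) sequentially" for v r
    using g(2)[of v] cInf_lower[OF _ bdd, of r v] that by (simp add: R_def)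
  have inv: "g (S v) = g v" for v
  proof -
    \<comment> \<open>The orbit sum of S v - v telescopes to two boundary terms of modulus at most 6
      \<parallel>v\<parallel> each; divided by n they vanish in the limit.\<close>
    have tele: "w n (S v - v) = (1 / real n) * (Re (\<Omega> ((S ^^ n) v)) - Re (\<Omega> v))" for n v
    proof -
      have "Re (\<Omega> ((S ^^ k) (S v - v))) = Re (\<Omega> ((S ^^ Suc k) v)) - Re (\<Omega> ((S ^^ k) v))" for k
        by (simp only: clinear_diff[OF lin] funpow_Suc_right comp_def minus_complex.sel)
      then show ?thesis
        using sum_lessThan_telescope[of "\<lambda>k. Re (\<Omega> ((S ^^ k) v))" n] by (simp add: w_def)
    qed
    have half: "g (S v - v) \<le> 0" for v
    proof (rule field_le_epsilon)
      fix e :: real assume e: "e > 0"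
      have "(\<lambda>n. 12 * norm v / real n) \<longlonglongrightarrow> 0" by (rule lim_const_over_n)
      then have "eventually (\<lambda>n. 12 * norm v / real n < e) sequentially"
        using e by (rule order_tendstoD)
      then have "eventually (\<lambda>n. w n (S v - v) \<le> 0 + e) sequentially"
      proof eventually_elim
        case (elim n)
        have "Re (\<Omega> ((S ^^ n) v)) - Re (\<Omega> v) \<le> 12 * norm v"
          using order_trans[OF abs_Re_le_cmod state_norm_le[OF st, of n v]]
            order_trans[OF abs_Re_le_cmod state_norm_le[OF \<Omega>, of v]] by linarith
        then have "w n (S v - v) \<le> (1 / real n) * (12 * norm v)"
          unfolding tele by (intro mult_left_mono) auto
        then show ?case using elim by simp
      qed
      then show "g (S v - v) \<le> 0 + e" by (rule gle)
    qed
    have "g (S v - v) = 0"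
      using half[of v] half[of "- v"]
      by (simp add: linear_diff[OF g(1)] linear_neg[OF g(1)]
          clinear_minus[OF pos_unital_clinear[OF S]])
    then show ?thesis by (simp add: linear_diff[OF g(1)])
  qed
  have pos: "g y \<ge> 0" if y: "pos y" for y
  proof -
    have "Re (\<Omega> ((S ^^ k) y)) \<ge> 0" for k
      using pos_unital_pos[OF st[unfolded state_iff_pos_unital] y, of k]
      by (simp add: pos_complex_iff complex_nonneg_Reals_iff)
    then have "w n (- y) \<le> 0" for n by (simp add: w_minus) (simp add: w_def sum_nonneg)
    then show ?thesis using gle[of "- y" 0] by (simp add: linear_neg[OF g(1)])
  qed
  have "g 1 = 1"
  proof -
    \<comment> \<open>The average over the empty range n = 0 is 0, so the value 1 starts at n =
      1.\<close>
    have w1: "w n 1 = 1" if "n \<ge> 1" for n using that by (simp add: w_def state_1[OF st])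
    have "eventually (\<lambda>n. w n 1 \<le> 1) sequentially" "eventually (\<lambda>n. w n (- 1) \<le> - 1) sequentially"
      using eventually_ge_at_top[of 1] by (eventually_elim, simp add: w1 w_minus)+
    then show ?thesis using gle[of 1 1] gle[of "- 1" "- 1"] by (simp add: linear_neg[OF g(1)])
  qed
  then have "state (cext g)" by (intro state_cext g(1) pos)
  then have "cext g = \<Phi>" by (rule uniq) (rule linear_invariant_cext[OF g(1) S inv])
  then have "Inf (R z) = Re (\<Phi> z)" using g(3) cext_selfadj[OF g(1) z] by auto
  then obtain r where r: "r \<in> R z" "r < Re (\<Phi> z) + e"
    using cInf_lessD[OF ne, of z "Re (\<Phi> z) + e"] e by auto
  have "eventually (\<lambda>n. w n z \<le> r) sequentially" using r(1) by (simp add: R_def)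
  then have "eventually (\<lambda>n. w n z < Re (\<Phi> z) + e) sequentially"
    by eventually_elim (use r(2) in simp)
  then show ?thesis by (simp only: w_def)
qed

text \<open>The one-sided bound, applied to z and to -z, controls limsup and liminf.\<close>

lemma uniquely_ergodic_average:
  fixes S :: "'a::unital_cstar_algebra \<Rightarrow> 'a"
  assumes S: "pos_unital S" and \<Omega>: "state \<Omega>" and \<Phi>: "state \<Phi>"
    and uniq: "\<And>\<omega>. state \<omega> \<Longrightarrow> \<omega> \<circ> S = \<omega> \<Longrightarrow> \<omega> = \<Phi>"
    and z: "adj z = z"
  shows "(\<lambda>n. (1 / real n) * (\<Sum>k<n. Re (\<Omega> ((S ^^ k) z)))) \<longlonglongrightarrow> Re (\<Phi> z)"
proof (rule order_tendstoI)
  let ?w = "\<lambda>n z. (1 / real n) * (\<Sum>k<n. Re (\<Omega> ((S ^^ k) z)))"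
  have ev: "eventually (\<lambda>n. ?w n y < Re (\<Phi> y) + e) sequentially" if "adj y = y" "e > 0" for y e
    using uniquely_ergodic_limsup_average[OF S \<Omega> uniq that] by blast
  show "eventually (\<lambda>n. ?w n z < r) sequentially" if "Re (\<Phi> z) < r" for r
    using ev[OF z, of "r - Re (\<Phi> z)"] that by simp
  show "eventually (\<lambda>n. r < ?w n z) sequentially" if r: "r < Re (\<Phi> z)" for r
  proof -
    have "?w n (- z) = - ?w n z" for n
      by (simp add: clinear_minus[OF state_clinear[OF state_compose_funpow[OF \<Omega> S]]] sum_negf)
    moreover have "Re (\<Phi> (- z)) = - Re (\<Phi> z)" by (simp add: clinear_minus[OF state_clinear[OF \<Phi>]])
    moreover have "adj (- z) = - z" using z by (simp add: adj_minus)
    ultimately show ?thesis using ev[of "- z" "Re (\<Phi> z) - r"] r by simp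
  qed
qed

lemma funpow_tensor:
  assumes "\<And>a b. TT (tens a b) = tens (T a) (H b)"
  shows "(TT ^^ k) (tens a b) = tens ((T ^^ k) a) ((H ^^ k) b)"
  by (induction k) (auto simp: assms)

section \<open>The tensor square\<close>

text \<open>For a state \<open>\<psi>\<close> and \<open>\<phi>(x) = 0\<close> one has
  \<open>\<bar>\<psi>(T\<^sup>k x)\<bar>\<^sup>2 = (\<psi> \<otimes> \<psi>)((T \<otimes> T)\<^sup>k (x \<otimes> x\<^sup>*))\<close>.\<close>

lemma uniquely_ergodic_tensor_imp_strictly_weak_mixing:
  fixes T :: "'a::unital_cstar_algebra \<Rightarrow> 'a"
    and tens :: "'a \<Rightarrow> 'a \<Rightarrow> 'c::unital_cstar_algebra"
  assumes \<phi>: "state \<phi>" and T: "pos_unital T" and tens: "is_min_tensor_product tens"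
    and \<Phi>: "is_product_state tens \<phi> \<phi> \<Phi>" and TT: "is_tensor_ucp tens T T TT"
    and ue: "uniquely_ergodic \<Phi> TT"
  shows "strictly_weak_mixing \<phi> T"
  unfolding strictly_weak_mixing_iff
proof (intro allI ballI)
  fix x :: 'a and \<psi> :: "'a \<Rightarrow> complex"
  have S: "pos_unital TT" using TT ucp_imp_pos_unital by (auto simp: is_tensor_ucp_def)
  have TTk: "(TT ^^ k) (tens a b) = tens ((T ^^ k) a) ((T ^^ k) b)" for k a b
    using TT by (intro funpow_tensor) (simp add: is_tensor_ucp_def)
  have st\<Phi>: "state \<Phi>" and \<Phi>t: "\<And>a b. \<Phi> (tens a b) = \<phi> a * \<phi> b"
    using \<Phi> by (auto simp: is_product_state_def)
  have uniq: "\<omega> = \<Phi>" if "state \<omega>" "\<omega> \<circ> TT = \<omega>" for \<omega>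
    using ue that by (auto simp: uniquely_ergodic_def)
  note Tk = pos_unital_funpow[OF T]
  assume "\<psi> \<in> cdual"
  then show "cesaro_null (\<lambda>k. \<psi> ((T ^^ k) x) - \<psi> 1 * \<phi> x)"
  proof (induction rule: cdual_state_induct)
    case zero
    show ?case by (simp add: cesaro_null_0)
  next
    case (add f g)
    show ?case using cesaro_null_add[OF add] by (simp add: algebra_simps)
  next
    case (state c \<psi>)
    note lin = state_clinear[OF state]
    define y where "y = x - \<phi> x *\<^sub>C 1"
    have \<phi>y: "\<phi> y = 0"
      by (simp add: y_def clinear_diff[OF state_clinear[OF \<phi>]]
          clinear_scaleC_complex[OF state_clinear[OF \<phi>]] state_1[OF \<phi>])
    have \<psi>y: "\<psi> ((T ^^ k) y) = \<psi> ((T ^^ k) x) - \<phi> x" for k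
      by (simp add: y_def clinear_diff[OF pos_unital_clinear[OF Tk]] clinear_diff[OF lin]
          clinear_scaleC[OF pos_unital_clinear[OF Tk]] clinear_scaleC_complex[OF lin]
          pos_unital_1[OF Tk] state_1[OF state])
    obtain \<Omega> where \<Omega>: "state \<Omega>" and \<Omega>t: "\<And>a b. \<Omega> (tens a b) = \<psi> a * \<psi> b"
      by (rule product_state_exists[OF tens state state]) (rule that)
    have sq: "\<Omega> ((TT ^^ k) (tens y (adj y))) = complex_of_real ((cmod (\<psi> ((T ^^ k) y)))\<^sup>2)" for k
      by (simp only: TTk \<Omega>t pos_unital_adj[OF Tk] state_adj[OF state] complex_norm_square)
    \<comment> \<open>y \<otimes> y^* need not be self-adjoint, as its adjoint is y^* \<otimes> y,
      while the averaging result asks for self-adjoint elements. The values of \<Omega> along its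
      orbit are real, so its real part has the same values.\<close>
    define u where "u = rpart (tens y (adj y))"
    have sa: "adj u = u" by (simp add: u_def adj_rpart)
    note Sk = state_compose_funpow[OF \<Omega> S]
    have "Re (\<Omega> ((TT ^^ k) u)) = (cmod (\<psi> ((T ^^ k) y)))\<^sup>2" for k
    proof -
      have "\<Omega> ((TT ^^ k) u) = (1 / 2) *\<^sub>R (\<Omega> ((TT ^^ k) (tens y (adj y)))
          + cnj (\<Omega> ((TT ^^ k) (tens y (adj y)))))"
        by (simp add: u_def rpart_def clinear_add[OF state_clinear[OF Sk]]
            clinear_scaleR[OF state_clinear[OF Sk]] state_adj[OF Sk])
      then show ?thesis by (simp add: sq)
    qed
    moreover have "Re (\<Phi> u) = 0"
      by (simp add: u_def rpart_def clinear_add[OF state_clinear[OF st\<Phi>]]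
            clinear_scaleR[OF state_clinear[OF st\<Phi>]] state_adj[OF st\<Phi>] \<Phi>t \<phi>y)
    ultimately have "(\<lambda>n. (1 / real n) * (\<Sum>k<n. (cmod (\<psi> ((T ^^ k) y)))\<^sup>2)) \<longlonglongrightarrow> 0"
      using uniquely_ergodic_average[OF S \<Omega> st\<Phi> uniq sa] by simp
    then have "cesaro_null (\<lambda>k. \<psi> ((T ^^ k) y))" by (rule cesaro_null_square)
    then have "cesaro_null (\<lambda>k. c * \<psi> ((T ^^ k) y))" by (rule cesaro_null_mult)
    then show ?case by (simp add: \<psi>y state_1[OF state] algebra_simps)
  qed
qed

text \<open>Reduces mixing to elementary tensors. Closedness holds because the deviation at z is at
  most 12 K \<parallel>z\<parallel> for all k, with 6 K \<parallel>z\<parallel> from each of its two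
  terms.\<close>

lemma closed_subspace_cesaro_null:
  fixes S :: "'c::unital_cstar_algebra \<Rightarrow> 'c"
  assumes S: "pos_unital S" and \<Phi>: "state \<Phi>" and G: "G \<in> cdual"
  defines "Z \<equiv> {z. cesaro_null (\<lambda>k. G ((S ^^ k) z) - G 1 * \<Phi> z)}"
  shows "closed Z" "cvec.subspace Z"
proof -
  note lin = cdual_clinear[OF G] and Slin = pos_unital_clinear[OF pos_unital_funpow[OF S]]
    and \<Phi>lin = state_clinear[OF \<Phi>]
  show "cvec.subspace Z"
  proof (rule cvec.subspaceI)
    show "0 \<in> Z"
      by (simp add: Z_def clinear_0[OF lin] clinear_0[OF Slin] clinear_0[OF \<Phi>lin] cesaro_null_0)
    fix z w assume "z \<in> Z" "w \<in> Z"
    then have "cesaro_null (\<lambda>k. (G ((S ^^ k) z) - G 1 * \<Phi> z) + (G ((S ^^ k) w) - G 1 * \<Phi> w))"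
      by (intro cesaro_null_add) (simp_all add: Z_def)
    then show "z + w \<in> Z"
      by (simp add: Z_def clinear_add[OF lin] clinear_add[OF Slin] clinear_add[OF \<Phi>lin] algebra_simps)
  next
    fix c z assume "z \<in> Z"
    then have "cesaro_null (\<lambda>k. c * (G ((S ^^ k) z) - G 1 * \<Phi> z))"
      by (intro cesaro_null_mult) (simp add: Z_def)
    then show "c *\<^sub>C z \<in> Z"
      by (simp add: Z_def clinear_scaleC_complex[OF lin] clinear_scaleC[OF Slin]
          clinear_scaleC_complex[OF \<Phi>lin] algebra_simps)
  qed
  obtain K where K: "K \<ge> 0" "\<And>x. norm (G x) \<le> norm x * K"
    using bounded_linear.nonneg_bounded[OF cdual_bounded_linear[OF G]] by blast
  have diff_le: "cmod (G ((S ^^ k) z) - G 1 * \<Phi> z) \<le> 12 * K * norm z" for k z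
  proof -
    have "cmod (G ((S ^^ k) z)) \<le> norm ((S ^^ k) z) * K" by (rule K)
    also have "\<dots> \<le> 6 * norm z * K"
      by (intro mult_right_mono pos_unital_norm_le pos_unital_funpow S K)
    finally have 1: "cmod (G ((S ^^ k) z)) \<le> 6 * norm z * K" .
    have "cmod (G 1 * \<Phi> z) \<le> K * (6 * norm z)"
      unfolding norm_mult using K(2)[of 1] by (intro mult_mono state_norm_le \<Phi> K) auto
    then show ?thesis
      using 1 norm_triangle_ineq4[of "G ((S ^^ k) z)" "G 1 * \<Phi> z"] by (simp add: algebra_simps)
  qed
  show "closed Z"
    unfolding closure_subset_eq[symmetric]
  proof
    fix z assume z: "z \<in> closure Z"
    have "cesaro_null (\<lambda>k. G ((S ^^ k) z) - G 1 * \<Phi> z)"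
    proof (rule cesaro_null_approx)
      fix e :: real assume e: "e > 0"
      define d where "d = e / (12 * K + 1)"
      have d: "d > 0" "12 * K * d \<le> e" using e K(1) by (simp_all add: d_def field_simps)
      obtain y where y: "y \<in> Z" "dist y z < d" using z d(1) unfolding closure_approachable by blast
      have "cmod (G ((S ^^ k) z) - G 1 * \<Phi> z) \<le> cmod (G ((S ^^ k) y) - G 1 * \<Phi> y) + e" for k
      proof -
        have "G ((S ^^ k) z) - G 1 * \<Phi> z =
            (G ((S ^^ k) y) - G 1 * \<Phi> y) + (G ((S ^^ k) (z - y)) - G 1 * \<Phi> (z - y))"
          by (simp add: clinear_diff[OF lin] clinear_diff[OF Slin] clinear_diff[OF \<Phi>lin] algebra_simps)
        moreover have "cmod (G ((S ^^ k) (z - y)) - G 1 * \<Phi> (z - y)) \<le> e"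
        proof -
          have "norm (z - y) \<le> d" using y(2) by (simp add: dist_norm norm_minus_commute)
          then have "12 * K * norm (z - y) \<le> 12 * K * d" using K(1) by (intro mult_left_mono) auto
          then show ?thesis using diff_le[of k "z - y"] d(2) by linarith
        qed
        ultimately show ?thesis
          using norm_triangle_ineq[of "G ((S ^^ k) y) - G 1 * \<Phi> y"
              "G ((S ^^ k) (z - y)) - G 1 * \<Phi> (z - y)"] by simp
      qed
      then show "\<exists>a. cesaro_null a \<and> (\<forall>k. cmod (G ((S ^^ k) z) - G 1 * \<Phi> z) \<le> cmod (a k) + e)"
        using y(1) by (intro exI[of _ "\<lambda>k. G ((S ^^ k) y) - G 1 * \<Phi> y"]) (auto simp: Z_def)
    qed
    then show "z \<in> Z" by (simp add: Z_def)
  qed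
qed

text \<open>On elementary tensors the factor \<eta>(T^k b) is bounded uniformly in k, so the
  deviation is dominated by those of \<psi> and \<eta>; density and continuity give all z.\<close>

lemma strictly_weak_mixing_product_functional:
  fixes T :: "'a::unital_cstar_algebra \<Rightarrow> 'a"
    and tens :: "'a \<Rightarrow> 'a \<Rightarrow> 'c::unital_cstar_algebra"
  assumes T: "pos_unital T" and tens: "is_min_tensor_product tens"
    and \<Phi>: "is_product_state tens \<phi> \<phi> \<Phi>" and TT: "is_tensor_ucp tens T T TT"
    and swm: "strictly_weak_mixing \<phi> T" and G: "G \<in> product_functionals tens"
  shows "cesaro_null (\<lambda>k. G ((TT ^^ k) z) - G 1 * \<Phi> z)"
proof -
  have S: "pos_unital TT" using TT ucp_imp_pos_unital by (auto simp: is_tensor_ucp_def)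
  have TTk: "(TT ^^ k) (tens a b) = tens ((T ^^ k) a) ((T ^^ k) b)" for k a b
    using TT by (intro funpow_tensor) (simp add: is_tensor_ucp_def)
  have st\<Phi>: "state \<Phi>" and \<Phi>t: "\<And>a b. \<Phi> (tens a b) = \<phi> a * \<phi> b"
    using \<Phi> by (auto simp: is_product_state_def)
  obtain \<psi> \<eta> where Gc: "G \<in> cdual" and \<psi>: "\<psi> \<in> cdual" and \<eta>: "\<eta> \<in> cdual"
    and Gt: "\<And>a b. G (tens a b) = \<psi> a * \<eta> b"
    using G by (auto simp: product_functionals_def)
  have G1: "G 1 = \<psi> 1 * \<eta> 1" using Gt[of 1 1] by (simp add: tens_1[OF tens])
  obtain K where K: "K \<ge> 0" "\<And>x. norm (\<eta> x) \<le> norm x * K"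
    using bounded_linear.nonneg_bounded[OF cdual_bounded_linear[OF \<eta>]] by blast
  have elem: "cesaro_null (\<lambda>k. G ((TT ^^ k) (tens a b)) - G 1 * \<Phi> (tens a b))" for a b
  proof (rule cesaro_null_dominated)
    show "cesaro_null (\<lambda>k. \<psi> ((T ^^ k) a) - \<psi> 1 * \<phi> a)" "cesaro_null (\<lambda>k. \<eta> ((T ^^ k) b) - \<eta> 1 * \<phi> b)"
      using swm \<psi> \<eta> by (auto simp: strictly_weak_mixing_iff)
    fix k
    have "G ((TT ^^ k) (tens a b)) - G 1 * \<Phi> (tens a b) =
        \<eta> ((T ^^ k) b) * (\<psi> ((T ^^ k) a) - \<psi> 1 * \<phi> a) +
        (\<psi> 1 * \<phi> a) * (\<eta> ((T ^^ k) b) - \<eta> 1 * \<phi> b)"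
      by (simp add: TTk Gt G1 \<Phi>t algebra_simps)
    then have "cmod (G ((TT ^^ k) (tens a b)) - G 1 * \<Phi> (tens a b)) \<le>
        cmod (\<eta> ((T ^^ k) b)) * cmod (\<psi> ((T ^^ k) a) - \<psi> 1 * \<phi> a) +
        cmod (\<psi> 1 * \<phi> a) * cmod (\<eta> ((T ^^ k) b) - \<eta> 1 * \<phi> b)"
      by (metis norm_mult norm_triangle_ineq)
    also have "cmod (\<eta> ((T ^^ k) b)) \<le> 6 * norm b * K"
      by (rule order_trans[OF K(2)]) (intro mult_right_mono pos_unital_norm_le pos_unital_funpow T K)
    finally show "cmod (G ((TT ^^ k) (tens a b)) - G 1 * \<Phi> (tens a b)) \<le>
        (6 * norm b * K) * cmod (\<psi> ((T ^^ k) a) - \<psi> 1 * \<phi> a) +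
        cmod (\<psi> 1 * \<phi> a) * cmod (\<eta> ((T ^^ k) b) - \<eta> 1 * \<phi> b)"
      by (simp add: mult_right_mono)
  qed
  have "z \<in> {z. cesaro_null (\<lambda>k. G ((TT ^^ k) z) - G 1 * \<Phi> z)}"
    by (rule tensor_induct[OF tens closed_subspace_cesaro_null[OF S st\<Phi> Gc]]) (simp add: elem)
  then show ?thesis by simp
qed

text \<open>Closeness of functionals in norm suffices since the orbit of z stays in the ball of
  radius 6 \<parallel>z\<parallel>: replacing F by a sum of product functionals changes the
  deviation by at most 12 \<parallel>z\<parallel> d, for all k.\<close>

lemma strictly_weak_mixing_tensor:
  fixes T :: "'a::unital_cstar_algebra \<Rightarrow> 'a"
    and tens :: "'a \<Rightarrow> 'a \<Rightarrow> 'c::unital_cstar_algebra"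
  assumes T: "pos_unital T" and tens: "is_min_tensor_product tens"
    and \<Phi>: "is_product_state tens \<phi> \<phi> \<Phi>" and TT: "is_tensor_ucp tens T T TT"
    and dense: "product_functionals_dense tens" and swm: "strictly_weak_mixing \<phi> T"
  shows "strictly_weak_mixing \<Phi> TT"
  unfolding strictly_weak_mixing_iff
proof (intro allI ballI cesaro_null_approx)
  fix z :: 'c and F :: "'c \<Rightarrow> complex" and e :: real
  assume F: "F \<in> cdual" and e: "e > 0"
  have S: "pos_unital TT" using TT ucp_imp_pos_unital by (auto simp: is_tensor_ucp_def)
  have st\<Phi>: "state \<Phi>" using \<Phi> by (auto simp: is_product_state_def)
  define d where "d = e / (12 * norm z + 1)"
  have d: "d > 0" "12 * norm z * d \<le> e"
    using e by (simp_all add: d_def field_simps add_pos_nonneg)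
  obtain m :: nat and G where G: "\<And>i. i < m \<Longrightarrow> G i \<in> product_functionals tens"
    and on: "onorm (\<lambda>z. F z - (\<Sum>i<m. G i z)) < d"
    using dense F d(1) unfolding product_functionals_dense_def by blast
  have Gc: "G i \<in> cdual" if "i < m" for i using G[OF that] by (simp add: product_functionals_def)
  define H where "H y = (\<Sum>i<m. G i y)" for y
  have "bounded_linear (\<lambda>z. F z - (\<Sum>i<m. G i z))"
    by (intro bounded_linear_sub bounded_linear_sum cdual_bounded_linear F Gc) simp
  then have FH: "cmod (F y - H y) \<le> d * norm y" for y
    using onorm[of "\<lambda>z. F z - (\<Sum>i<m. G i z)" y] on mult_right_mono[of _ d "norm y"]
    unfolding H_def by (meson less_imp_le norm_ge_zero order_trans)
  have "cesaro_null (\<lambda>k. \<Sum>i<m. G i ((TT ^^ k) z) - G i 1 * \<Phi> z)"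
    by (intro cesaro_null_sum strictly_weak_mixing_product_functional[OF T tens \<Phi> TT swm] G) simp
  then have null: "cesaro_null (\<lambda>k. H ((TT ^^ k) z) - H 1 * \<Phi> z)"
    by (simp add: H_def sum_subtractf sum_distrib_right)
  have "cmod (F ((TT ^^ k) z) - F 1 * \<Phi> z) \<le> cmod (H ((TT ^^ k) z) - H 1 * \<Phi> z) + e" for k
  proof -
    have "cmod (F ((TT ^^ k) z) - H ((TT ^^ k) z)) \<le> d * (6 * norm z)"
      by (rule order_trans[OF FH])
        (use d(1) in \<open>intro mult_left_mono pos_unital_norm_le pos_unital_funpow S; simp\<close>)
    moreover have "cmod ((F 1 - H 1) * \<Phi> z) \<le> d * (6 * norm z)"
      unfolding norm_mult using FH[of 1] d(1) by (intro mult_mono state_norm_le st\<Phi>) auto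
    moreover have "F ((TT ^^ k) z) - F 1 * \<Phi> z = (H ((TT ^^ k) z) - H 1 * \<Phi> z) +
        ((F ((TT ^^ k) z) - H ((TT ^^ k) z)) - (F 1 - H 1) * \<Phi> z)"
      by (simp add: algebra_simps)
    then have "cmod (F ((TT ^^ k) z) - F 1 * \<Phi> z) \<le> cmod (H ((TT ^^ k) z) - H 1 * \<Phi> z) +
        (cmod (F ((TT ^^ k) z) - H ((TT ^^ k) z)) + cmod ((F 1 - H 1) * \<Phi> z))"
      by (metis add_left_mono norm_triangle_ineq norm_triangle_ineq4 order_trans)
    ultimately show ?thesis using d(2) by (simp add: algebra_simps)
  qed
  then show "\<exists>a. cesaro_null a \<and> (\<forall>k. cmod (F ((TT ^^ k) z) - F 1 * \<Phi> z) \<le> cmod (a k) + e)"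
    using null by blast
qed

lemma invariant_funpow: "\<omega> \<circ> S = \<omega> \<Longrightarrow> \<omega> ((S ^^ k) z) = \<omega> z"
  by (induction k) (auto simp: fun_eq_iff)

text \<open>Along an invariant \<omega> the deviation |\<omega>(z) - \<Phi>(z)| does not depend on
  k, so its averages tend to 0 only if it is 0.\<close>

lemma strictly_weak_mixing_imp_uniquely_ergodic:
  assumes \<Phi>: "state \<Phi>" "\<Phi> \<circ> S = \<Phi>" and swm: "strictly_weak_mixing \<Phi> S"
  shows "uniquely_ergodic \<Phi> S"
  unfolding uniquely_ergodic_def
proof (intro equalityI subsetI)
  fix \<omega> assume "\<omega> \<in> {\<omega>. state \<omega> \<and> \<omega> \<circ> S = \<omega>}"
  then have \<omega>: "state \<omega>" "\<omega> \<circ> S = \<omega>" by auto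
  have "\<omega> z = \<Phi> z" for z
  proof -
    have "cesaro_null (\<lambda>k. \<omega> ((S ^^ k) z) - \<omega> 1 * \<Phi> z)"
      using swm state_in_cdual[OF \<omega>(1)] by (auto simp: strictly_weak_mixing_iff)
    then have lim: "(\<lambda>n. (1 / real n) * (\<Sum>k<n. cmod (\<omega> z - \<Phi> z))) \<longlonglongrightarrow> 0"
      by (simp add: cesaro_null_def invariant_funpow[OF \<omega>(2)] state_1[OF \<omega>(1)])
    have "(\<lambda>n. (1 / real n) * (\<Sum>k<n. cmod (\<omega> z - \<Phi> z))) \<longlonglongrightarrow> cmod (\<omega> z - \<Phi> z)"
    proof (rule tendsto_eventually)
      show "eventually (\<lambda>n. (1 / real n) * (\<Sum>k<n. cmod (\<omega> z - \<Phi> z)) = cmod (\<omega> z - \<Phi> z)) sequentially"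
        using eventually_gt_at_top[of 0] by eventually_elim simp
    qed
    then have "cmod (\<omega> z - \<Phi> z) = 0" using lim by (rule LIMSEQ_unique)
    then show ?thesis by simp
  qed
  then show "\<omega> \<in> {\<Phi>}" by auto
qed (use \<Phi> in auto)

text \<open>On elementary tensors this is the invariance of \<phi>, and the equality set is a closed
  subspace. It puts \<Phi> itself among the invariant states in
  \<open>uniquely_ergodic\<close>.\<close>

lemma product_state_invariant:
  fixes tens :: "'a::unital_cstar_algebra \<Rightarrow> 'a \<Rightarrow> 'c::unital_cstar_algebra"
  assumes tens: "is_min_tensor_product tens" and inv: "\<phi> \<circ> T = \<phi>"
    and \<Phi>: "is_product_state tens \<phi> \<phi> \<Phi>" and TT: "is_tensor_ucp tens T T TT"
  shows "\<Phi> \<circ> TT = \<Phi>"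
proof
  fix z
  have S: "pos_unital TT" using TT ucp_imp_pos_unital by (auto simp: is_tensor_ucp_def)
  have st: "state \<Phi>" using \<Phi> by (simp add: is_product_state_def)
  note lin = state_clinear[OF st] pos_unital_clinear[OF S]
  have bl: "bounded_linear \<Phi>" by (rule cdual_bounded_linear[OF state_in_cdual[OF st]])
  have "z \<in> {z. \<Phi> (TT z) = \<Phi> z}"
  proof (rule tensor_induct[OF tens])
    show "closed {z. \<Phi> (TT z) = \<Phi> z}"
      by (intro closed_Collect_eq linear_continuous_on bl
          bounded_linear_compose[OF bl pos_unital_bounded_linear[OF S]])
    show "cvec.subspace {z. \<Phi> (TT z) = \<Phi> z}"
      by (rule cvec.subspaceI) (simp_all add: clinear_0[OF lin(1)] clinear_0[OF lin(2)]
          clinear_add[OF lin(1)] clinear_add[OF lin(2)] clinear_scaleC[OF lin(1)] clinear_scaleC[OF lin(2)])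
    show "tens a b \<in> {z. \<Phi> (TT z) = \<Phi> z}" for a b
      using \<Phi> TT fun_cong[OF inv, of a] fun_cong[OF inv, of b]
      by (simp add: is_product_state_def is_tensor_ucp_def)
  qed
  then show "(\<Phi> \<circ> TT) z = \<Phi> z" by simp
qed

theorem corollary3p2:
  fixes \<phi> :: "'a::unital_cstar_algebra \<Rightarrow> complex"
    and T :: "'a \<Rightarrow> 'a"
    and tens :: "'a \<Rightarrow> 'a \<Rightarrow> 'c::unital_cstar_algebra"
    and \<phi>\<phi> :: "'c \<Rightarrow> complex"
    and TT :: "'c \<Rightarrow> 'c"
  assumes "state_preserving_system \<phi> T"
    and "is_min_tensor_product tens"
    and "is_product_state tens \<phi> \<phi> \<phi>\<phi>"
    and "is_tensor_ucp tens T T TT"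
  shows "(uniquely_ergodic \<phi>\<phi> TT \<longrightarrow> strictly_weak_mixing \<phi> T) \<and>
    (product_functionals_dense tens \<longrightarrow>
      (uniquely_ergodic \<phi>\<phi> TT \<longleftrightarrow> strictly_weak_mixing \<phi> T) \<and>
      (strictly_weak_mixing \<phi> T \<longleftrightarrow> strictly_weak_mixing \<phi>\<phi> TT))"
proof -
  have \<phi>: "state \<phi>" "\<phi> \<circ> T = \<phi>" and T: "pos_unital T"
    using assms(1) ucp_imp_pos_unital by (auto simp: state_preserving_system_def)
  have 12: "strictly_weak_mixing \<phi> T" if "uniquely_ergodic \<phi>\<phi> TT"
    by (rule uniquely_ergodic_tensor_imp_strictly_weak_mixing[OF \<phi>(1) T assms(2-4) that])
  have 23: "strictly_weak_mixing \<phi>\<phi> TT" if "product_functionals_dense tens" "strictly_weak_mixing \<phi> T"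
    by (rule strictly_weak_mixing_tensor[OF T assms(2-4) that])
  have 31: "uniquely_ergodic \<phi>\<phi> TT" if "strictly_weak_mixing \<phi>\<phi> TT"
    using assms(3) product_state_invariant[OF assms(2) \<phi>(2) assms(3,4)] that
    by (intro strictly_weak_mixing_imp_uniquely_ergodic) (auto simp: is_product_state_def)
  show ?thesis using 12 23 31 by blast
qed

end
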